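(* For every $\beta\in(\alpha,+\infty)$ there exists a constant $C=C(\beta)\in[1,+\infty)$ such that for all $u\in C(K)$ $$\frac1C\,\mathcal{E}_\beta(u,u)\le E_\beta(u,u)\le C\,\mathcal{E}_\beta(u,u),$$ where $$E_\beta(u,u)=\sum_{n=1}^\infty 3^{(\beta-\alpha)n}\sum_{w\in W_n}\ \sum_{\substack{p,q\in V_w\\ |p-q|=2^{-1}\cdot 3^{-n}}}(u(p)-u(q))^2,\qquad \mathcal{E}_\beta(u,u)=\int_K\int_K\frac{(u(x)-u(y))^2}{|x-y|^{\alpha+\beta}}\,\nu(dx)\,\nu(dy),$$ and both sides are allowed to be $+\infty$ (in particular one is finite if and only if the other is).
   Context: In $\mathbb{R}^2$ let $p_0=(0,0)$, $p_1=(\frac12,0)$, $p_2=(1,0)$, $p_3=(1,\frac12)$, $p_4=(1,1)$, $p_5=(\frac12,1)$, $p_6=(0,1)$, $p_7=(0,\frac12)$, and $f_i(x)=(x+2p_i)/3$ for $i=0,\ldots,7$. The Sierpinski carpet $K$ is the unique non-empty compact set with $K=\bigcup_{i=0}^7 f_i(K)$. Let $\alpha=\log 8/\log 3$ be its Hausdorff dimension and $\nu$ the normalized $\alpha$-dimensional Hausdorff measure on $K$ ($\nu(K)=1$); $|\cdot|$ is the Euclidean norm. Let $V_0=\{p_0,\ldots,p_7\}$. For $n\ge1$ let $W_n$ be the set of words $w=w_1\ldots w_n$ with $w_i\in\{0,\ldots,7\}$; for $w\in W_n$ put $f_w=f_{w_1}\circ\cdots\circ f_{w_n}$ and $V_w=f_w(V_0)$.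 In sums over $p,q\in V_w$ with $|p-q|=2^{-1}\cdot3^{-n}$ each unordered pair is counted once. *)

theory Defs
  imports "HOL-Analysis.Analysis"
begin

text \<open>
  Boundedness is required explicitly because \<open>diameter\<close> carries no information about unbounded
  sets.  The exponent is meant to be positive: then \<open>0 powr s = 0\<close>, so empty sets and singletons
  in a covering contribute nothing and countable coverings include finite ones.
\<close>

definition hausdorff_pre :: "real \<Rightarrow> real \<Rightarrow> 'a::metric_space set \<Rightarrow> ennreal" where
  "hausdorff_pre s \<delta> A =
     (INF U \<in> {U :: nat \<Rightarrow> 'a set. A \<subseteq> (\<Union>i. U i) \<and> (\<forall>i. bounded (U i) \<and> diameter (U i) \<le> \<delta>)}.
        \<Sum>i. ennreal (diameter (U i) powr s))"

definition hausdorff_outer :: "real \<Rightarrow> 'a::metric_space set \<Rightarrow> ennreal" where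
  "hausdorff_outer s A = (SUP \<delta> \<in> {0<..}. hausdorff_pre s \<delta> A)"

definition hausdorff_measure :: "real \<Rightarrow> 'a::metric_space measure" where
  "hausdorff_measure s = measure_of UNIV (sets borel) (hausdorff_outer s)"

lemma space_hausdorff_measure [simp]: "space (hausdorff_measure s) = UNIV"
  by (simp add: hausdorff_measure_def space_measure_of_conv)

lemma sets_hausdorff_measure [simp, measurable_cong]: "sets (hausdorff_measure s) = sets borel"
  unfolding hausdorff_measure_def
  by (metis sets.sigma_sets_eq sets_measure_of space_borel subset_UNIV Pow_UNIV)

definition carpet_pt :: "nat \<Rightarrow> real^2" where
  "carpet_pt i =
     [vector [0, 0], vector [1/2, 0], vector [1, 0], vector [1, 1/2],
      vector [1, 1], vector [1/2, 1], vector [0, 1], vector [0, 1/2]] ! i"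

definition carpet_map :: "nat \<Rightarrow> real^2 \<Rightarrow> real^2" where
  "carpet_map i x = (1/3) *\<^sub>R (x + 2 *\<^sub>R carpet_pt i)"

definition carpet :: "(real^2) set" where
  "carpet = (THE K. compact K \<and> K \<noteq> {} \<and> K = (\<Union>i<8. carpet_map i ` K))"

definition carpet_dim :: real where
  "carpet_dim = ln 8 / ln 3"

text \<open>The measure below lives on the whole plane, but is concentrated on the carpet.\<close>

definition carpet_measure :: "(real^2) measure" where
  "carpet_measure = uniform_measure (hausdorff_measure carpet_dim) carpet"

definition words :: "nat \<Rightarrow> nat list set" where
  "words n = {w. length w = n \<and> set w \<subseteq> {..<8}}"

definition word_map :: "nat list \<Rightarrow> real^2 \<Rightarrow> real^2" where
  "word_map w = foldr (\<circ>) (map carpet_map w) id"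

definition cell_vertices :: "nat list \<Rightarrow> (real^2) set" where
  "cell_vertices w = word_map w ` carpet_pt ` {..<8}"

text \<open>
  The innermost sum ranges over ordered pairs \<open>(p, q)\<close>; these satisfy \<open>p \<noteq> q\<close>, so every unordered
  pair occurs exactly twice, whence the division by 2.  The series starts at level 1, hence \<open>Suc\<close>.
\<close>

definition level_energy :: "real \<Rightarrow> nat \<Rightarrow> (real^2 \<Rightarrow> real) \<Rightarrow> real" where
  "level_energy \<beta> n u =
     3 powr ((\<beta> - carpet_dim) * real n) *
       (\<Sum>w\<in>words n.
          (\<Sum>(p, q) \<in> {(p, q). p \<in> cell_vertices w \<and> q \<in> cell_vertices w \<and>
                               norm (p - q) = 1 / (2 * 3 ^ n)}.
             (u p - u q)\<^sup>2) / 2)"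

definition discrete_energy :: "real \<Rightarrow> (real^2 \<Rightarrow> real) \<Rightarrow> ennreal" where
  "discrete_energy \<beta> u = (\<Sum>n. ennreal (level_energy \<beta> (Suc n) u))"

text \<open>
  On the diagonal the integrand is \<open>0 / 0 = 0\<close>.
\<close>

definition besov_energy :: "real \<Rightarrow> (real^2 \<Rightarrow> real) \<Rightarrow> ennreal" where
  "besov_energy \<beta> u =
     (\<integral>\<^sup>+x\<in>carpet. (\<integral>\<^sup>+y\<in>carpet.
        ennreal ((u x - u y)\<^sup>2 / norm (x - y) powr (carpet_dim + \<beta>))
      \<partial>carpet_measure) \<partial>carpet_measure)"

end

theory Submission
  imports Defs
begin

text \<open>
  Both energies are compared scale by scale. Let \<open>\<alpha>\<close> be the dimension, so that \<open>3 powr \<alpha> = 8\<close>, and write \<open>r\<close> for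
  \<open>3 powr (\<beta> - \<alpha>)\<close>, the ratio of the weights in the discrete energy; \<open>r > 1\<close> by assumption. A cell of level \<open>n\<close> is the image of
  the carpet under \<open>word_map w\<close> for a word \<open>w\<close> of length \<open>n\<close>. Its measure is \<open>1/8^n\<close> (lemma \<open>emeasure_cell\<close>), which rests on the
  fact that the Hausdorff measure of the carpet is positive and finite; the lower bound is a counting version of the mass distribution
  principle (\<open>carpet_pre_lower\<close>).

  In one direction, the value of \<open>u\<close> at a vertex of a cell is the limit of the averages of \<open>u\<close> over a decreasing sequence of cells. The
  square of the difference of two successive averages is at most \<open>8 * 64^n\<close> times the integral \<open>A w\<close> of \<open>(u x - u y)^2\<close> over pairs of
  points of the larger cell (\<open>cell_average_diff_le\<close>). The differences are summed with a loss of a factor \<open>1 + e < r\<close> per step, which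
  the weights absorb (\<open>telescoping_series\<close>). So the discrete energy is bounded by the sum over all levels of \<open>r^n * 64^n\<close> times the
  integrals \<open>A w\<close> of that level. Since \<open>r * 64 = 3 powr (\<alpha> + \<beta>)\<close>, and a pair of points shares cells only up to the level where
  \<open>1/3^n\<close> is comparable to its distance, summing the geometric series recovers the kernel of the integral energy
  (\<open>cell_overlap_kernel\<close>).

  In the other direction, the kernel is at most the sum of \<open>3 powr ((\<alpha> + \<beta>) * (n + 1))\<close> over all levels \<open>n\<close> and all pairs of touching
  cells of level \<open>n\<close> that contain the two points (\<open>kernel_le_touching\<close>). Touching cells share a vertex
  (\<open>touching_share_vertex\<close>), so it remains to bound the integral over a cell of the
  square of the deviation of \<open>u\<close> from its value at a vertex. This integral is a limit of Riemann sums over the vertices of deeper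
  levels, and these sums are telescoped again: vertices of two successive levels within a cell are joined by a path of at most 56 edges
  of the finer level (\<open>subcell_vertex_diff\<close>), and refining the sums loses only a factor \<open>1/4\<close> per step.
\<close>

section \<open>Hausdorff measure on the Borel sets\<close>

lemma hausdorff_pre_le:
  assumes "A \<subseteq> (\<Union>i. U i)" "\<And>i. bounded (U i)" "\<And>i. diameter (U i) \<le> \<delta>"
  shows "hausdorff_pre s \<delta> A \<le> (\<Sum>i. ennreal (diameter (U i) powr s))"
  unfolding hausdorff_pre_def using assms by (intro INF_lower) auto

lemma hausdorff_pre_close:
  assumes "hausdorff_pre s \<delta> A < c"
  obtains U :: "nat \<Rightarrow> 'a::metric_space set" where
    "A \<subseteq> (\<Union>i. U i)" "\<And>i. bounded (U i)" "\<And>i. diameter (U i) \<le> \<delta>"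
    "(\<Sum>i. ennreal (diameter (U i) powr s)) < c"
  using assms unfolding hausdorff_pre_def INF_less_iff by auto

lemma hausdorff_pre_mono: "A \<subseteq> B \<Longrightarrow> hausdorff_pre s \<delta> A \<le> hausdorff_pre s \<delta> B"
  unfolding hausdorff_pre_def by (intro INF_superset_mono) auto

lemma hausdorff_pre_antimono: "\<delta> \<le> \<delta>' \<Longrightarrow> hausdorff_pre s \<delta>' A \<le> hausdorff_pre s \<delta> A"
  unfolding hausdorff_pre_def by (intro INF_superset_mono) (auto intro: order_trans)

lemma hausdorff_pre_empty: "\<delta> > 0 \<Longrightarrow> hausdorff_pre s \<delta> {} = 0"
  using hausdorff_pre_le[of "{}" "\<lambda>_. {}" \<delta> s] by simp

lemma hausdorff_pre_UN:
  assumes "\<delta> > 0"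
  shows "hausdorff_pre s \<delta> (\<Union>i. A i) \<le> (\<Sum>i. hausdorff_pre s \<delta> (A i :: 'a::metric_space set))"
proof (rule ennreal_le_epsilon)
  fix e :: real assume fin: "(\<Sum>i. hausdorff_pre s \<delta> (A i)) < top" and e: "0 < e"
  have "\<exists>U. A i \<subseteq> (\<Union>j. U j) \<and> (\<forall>j. bounded (U j) \<and> diameter (U j) \<le> \<delta>) \<and>
          (\<Sum>j. ennreal (diameter (U j :: 'a set) powr s)) \<le> hausdorff_pre s \<delta> (A i) + e * (1/2) ^ Suc i" for i
  proof -
    have "hausdorff_pre s \<delta> (A i) < hausdorff_pre s \<delta> (A i) + e * (1/2) ^ Suc i"
    proof -
      have "hausdorff_pre s \<delta> (A i) < top"
        using fin ennreal_suminf_lessD by blast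
      then show ?thesis using e
        by (metis add.right_neutral ennreal_add_left_cancel_less ennreal_less_zero_iff
            half_gt_zero_iff less_top mult_pos_pos zero_less_power zero_less_one
            infinity_ennreal_def)
    qed
    from hausdorff_pre_close[OF this] show ?thesis by (metis order.strict_implies_order)
  qed
  then obtain U where U: "\<And>i. A i \<subseteq> (\<Union>j. U i j)" "\<And>i j. bounded (U i j)" "\<And>i j. diameter (U i j) \<le> \<delta>"
     "\<And>i. (\<Sum>j. ennreal (diameter (U i j) powr s)) \<le> hausdorff_pre s \<delta> (A i) + e * (1/2) ^ Suc i"
    by metis
  define V where "V k = (case prod_decode k of (i,j) \<Rightarrow> U i j)" for k
  have "(\<Union>i. A i) \<subseteq> (\<Union>k. V k)"
  proof
    fix x assume "x \<in> (\<Union>i. A i)"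
    then obtain i j where "x \<in> U i j" using U(1) by blast
    then have "x \<in> V (prod_encode (i,j))" by (simp add: V_def)
    then show "x \<in> (\<Union>k. V k)" by blast
  qed
  then have "hausdorff_pre s \<delta> (\<Union>i. A i) \<le> (\<Sum>k. ennreal (diameter (V k) powr s))"
    by (rule hausdorff_pre_le) (auto simp: V_def U split: prod.split)
  also have "\<dots> = (\<Sum>k. (\<lambda>(i,j). ennreal (diameter (U i j) powr s)) (prod_decode k))"
    by (simp add: V_def case_prod_unfold)
  also have "\<dots> = (\<Sum>i. \<Sum>j. ennreal (diameter (U i j) powr s))"
    by (rule suminf_ennreal_2dimen) simp
  also have "\<dots> \<le> (\<Sum>i. hausdorff_pre s \<delta> (A i) + e * (1/2) ^ Suc i)"
    using U(4) by (intro suminf_le) auto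
  also have "\<dots> = (\<Sum>i. hausdorff_pre s \<delta> (A i)) + (\<Sum>n. ennreal e * ennreal ((1/2) ^ Suc n))"
    using \<open>0 < e\<close> by (subst suminf_add[symmetric])
       (auto simp del: ennreal_suminf_cmult simp add: ennreal_mult[symmetric])
  also have "\<dots> = (\<Sum>i. hausdorff_pre s \<delta> (A i)) + e"
    unfolding ennreal_suminf_cmult
    by (subst suminf_ennreal_eq[OF zero_le_power power_half_series]) auto
  finally show "hausdorff_pre s \<delta> (\<Union>i. A i) \<le> (\<Sum>i. hausdorff_pre s \<delta> (A i)) + e" .
qed

lemma hausdorff_pre_le_outer: "\<delta> > 0 \<Longrightarrow> hausdorff_pre s \<delta> A \<le> hausdorff_outer s A"
  unfolding hausdorff_outer_def by (intro SUP_upper) auto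

lemma hausdorff_outer_mono: "A \<subseteq> B \<Longrightarrow> hausdorff_outer s A \<le> hausdorff_outer s B"
  unfolding hausdorff_outer_def by (intro SUP_mono) (auto intro: hausdorff_pre_mono)

lemma hausdorff_outer_UN:
  "hausdorff_outer s (\<Union>i. A i) \<le> (\<Sum>i. hausdorff_outer s (A i :: 'a::metric_space set))"
  unfolding hausdorff_outer_def[of s "\<Union>i. A i"]
proof (rule SUP_least)
  fix \<delta> :: real assume "\<delta> \<in> {0<..}"
  then have "\<delta> > 0" by simp
  have "hausdorff_pre s \<delta> (\<Union>i. A i) \<le> (\<Sum>i. hausdorff_pre s \<delta> (A i))"
    by (rule hausdorff_pre_UN) fact
  also have "\<dots> \<le> (\<Sum>i. hausdorff_outer s (A i))"
    using \<open>\<delta> > 0\<close> by (intro suminf_le) (auto intro: hausdorff_pre_le_outer)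
  finally show "hausdorff_pre s \<delta> (\<Union>i. A i) \<le> (\<Sum>i. hausdorff_outer s (A i))" .
qed

lemma outer_measure_space_hausdorff: "outer_measure_space (Pow UNIV) (hausdorff_outer s)"
  unfolding outer_measure_space_def positive_def increasing_def countably_subadditive_def
proof (intro conjI ballI allI impI)
  show "hausdorff_outer s {} = 0"
    unfolding hausdorff_outer_def by (intro antisym SUP_least) (auto simp: hausdorff_pre_empty)
qed (auto intro: hausdorff_outer_mono hausdorff_outer_UN)

text \<open>
  A covering by sets of diameter less than the distance of \<open>A\<close> and \<open>B\<close> splits into a covering of \<open>A\<close> and a disjoint
  covering of \<open>B\<close>, since none of its members meets both.
\<close>

lemma hausdorff_outer_separated:
  fixes A B :: "'a::metric_space set"
  assumes "d > 0" and sep: "\<And>x y. x \<in> A \<Longrightarrow> y \<in> B \<Longrightarrow> d \<le> dist x y"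
  shows "hausdorff_outer s A + hausdorff_outer s B \<le> hausdorff_outer s (A \<union> B)"
proof -
  have small: "hausdorff_pre s \<delta> A + hausdorff_pre s \<delta> B \<le> hausdorff_pre s \<delta> (A \<union> B)"
    if "\<delta> > 0" "\<delta> < d" for \<delta>
    unfolding hausdorff_pre_def[of s \<delta> "A \<union> B"]
  proof (rule INF_greatest, clarify)
    fix U :: "nat \<Rightarrow> 'a set"
    assume cov: "A \<union> B \<subseteq> (\<Union>i. U i)" and U: "\<forall>i. bounded (U i) \<and> diameter (U i) \<le> \<delta>"
    define P where "P i = (if U i \<inter> A = {} then {} else U i)" for i
    define Q where "Q i = (if U i \<inter> B = {} then {} else U i)" for i
    have "U i \<inter> A = {} \<or> U i \<inter> B = {}" for i
    proof (rule ccontr)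
      assume "\<not> ?thesis"
      then obtain x y where "x \<in> U i" "x \<in> A" "y \<in> U i" "y \<in> B" by auto
      then have "d \<le> diameter (U i)"
        using sep diameter_bounded_bound U by (meson order_trans)
      then show False using U \<open>\<delta> < d\<close> by (metis leD order_trans)
    qed
    then have PQ: "ennreal (diameter (P i) powr s) + ennreal (diameter (Q i) powr s)
        \<le> ennreal (diameter (U i) powr s)" for i
      by (auto simp: P_def Q_def)
    have "hausdorff_pre s \<delta> A \<le> (\<Sum>i. ennreal (diameter (P i) powr s))"
      using cov U \<open>\<delta> > 0\<close> by (intro hausdorff_pre_le) (auto simp: P_def, blast)
    moreover have "hausdorff_pre s \<delta> B \<le> (\<Sum>i. ennreal (diameter (Q i) powr s))"
      using cov U \<open>\<delta> > 0\<close> by (intro hausdorff_pre_le) (auto simp: Q_def, blast)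
    ultimately have "hausdorff_pre s \<delta> A + hausdorff_pre s \<delta> B \<le>
        (\<Sum>i. ennreal (diameter (P i) powr s)) + (\<Sum>i. ennreal (diameter (Q i) powr s))"
      by (rule add_mono)
    also have "\<dots> = (\<Sum>i. ennreal (diameter (P i) powr s) + ennreal (diameter (Q i) powr s))"
      by (rule suminf_add) auto
    also have "\<dots> \<le> (\<Sum>i. ennreal (diameter (U i) powr s))"
      using PQ by (intro suminf_le) auto
    finally show "hausdorff_pre s \<delta> A + hausdorff_pre s \<delta> B \<le> (\<Sum>i. ennreal (diameter (U i) powr s))" .
  qed
  have "hausdorff_pre s \<delta> A + hausdorff_pre s \<delta>' B \<le> hausdorff_outer s (A \<union> B)"
    if "\<delta> > 0" "\<delta>' > 0" for \<delta> \<delta>'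
  proof -
    \<comment> \<open>Refining both coverings to a mesh below the separation only increases the pre-measures.\<close>
    define e where "e = min (min \<delta> \<delta>') (d/2)"
    have e: "e > 0" "e < d" "e \<le> \<delta>" "e \<le> \<delta>'" using that \<open>d > 0\<close> by (auto simp: e_def)
    have "hausdorff_pre s \<delta> A + hausdorff_pre s \<delta>' B \<le> hausdorff_pre s e A + hausdorff_pre s e B"
      using e by (intro add_mono hausdorff_pre_antimono)
    also have "\<dots> \<le> hausdorff_pre s e (A \<union> B)" using e by (intro small)
    also have "\<dots> \<le> hausdorff_outer s (A \<union> B)" using e by (intro hausdorff_pre_le_outer)
    finally show ?thesis .
  qed
  then have "hausdorff_outer s A + hausdorff_pre s \<delta>' B \<le> hausdorff_outer s (A \<union> B)" if "\<delta>' > 0" for \<delta>'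
    unfolding hausdorff_outer_def[of s A] using that
    by (subst ennreal_SUP_add_left[symmetric]) (auto intro!: SUP_least)
  then show ?thesis
    unfolding hausdorff_outer_def[of s B]
    by (subst ennreal_SUP_add_right) (auto intro!: SUP_least)
qed

text \<open>
  Caratheodory's criterion for metric outer measures. The part of a test set \<open>T\<close> at distance at least \<open>1/(k+1)\<close> from
  \<open>C\<close> is separated from \<open>T \<inter> C\<close>, so only the thin shells \<open>R j\<close> around \<open>C\<close> can spoil additivity. Shells with indices of
  equal parity are separated from each other, hence the measures of all shells add up to at most \<open>2 * f T\<close>, and the tails of this
  series vanish.
\<close>

lemma closed_in_lambda_system:
  fixes f :: "'a::metric_space set \<Rightarrow> ennreal"
  assumes f: "outer_measure_space (Pow UNIV) f"
    and sep: "\<And>A B d. d > 0 \<Longrightarrow> (\<And>x y. x \<in> A \<Longrightarrow> y \<in> B \<Longrightarrow> d \<le> dist x y) \<Longrightarrow> f A + f B \<le> f (A \<union> B)"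
    and "closed C"
  shows "C \<in> lambda_system UNIV (Pow UNIV) f"
proof -
  have mono: "f A \<le> f B" if "A \<subseteq> B" for A B
    using f that by (auto simp: outer_measure_space_def increasing_def)
  have empty: "f {} = 0" using f by (auto simp: outer_measure_space_def positive_def)
  interpret sigma_algebra "UNIV :: 'a set" "Pow UNIV" by (rule sigma_algebra_Pow)
  have subadd: "f (A \<union> B) \<le> f A + f B" for A B
  proof -
    have "subadditive (Pow UNIV) f"
      using countably_subadditive_subadditive[of f] f by (auto simp: outer_measure_space_def)
    then have "f (A \<union> (B - A)) \<le> f A + f (B - A)"
      by (rule subadditiveD) auto
    also have "\<dots> \<le> f A + f B" by (intro add_left_mono mono) auto
    finally show ?thesis by simp
  qed
  have csub: "f (\<Union>i. A i) \<le> (\<Sum>i. f (A i))" for A :: "nat \<Rightarrow> 'a set"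
  proof -
    have "f (\<Union>i. A i) = f (\<Union>i. disjointed A i)" by (simp add: UN_disjointed_eq)
    also have "\<dots> \<le> (\<Sum>i. f (disjointed A i))"
      using f by (auto simp: outer_measure_space_def countably_subadditive_def disjoint_family_disjointed)
    also have "\<dots> \<le> (\<Sum>i. f (A i))" by (intro suminf_le mono) (auto simp: disjointed_subset)
    finally show ?thesis .
  qed
  have main: "f (T \<inter> C) + f (T - C) \<le> f T" for T
  proof (cases "C = {} \<or> f T = top")
    case True then show ?thesis using empty by auto
  next
    case False
    then have "C \<noteq> {}" and fin: "f T < top" by (auto simp: less_top)
    define R where "R k = {x\<in>T. 1 / real (k+2) \<le> infdist x C \<and> infdist x C < 1 / real (k+1)}" for k
    have R_sum: "(\<Sum>j<n. f (R (2*j+e))) \<le> f (\<Union>j<n. R (2*j+e))" for n e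
    proof (induction n)
      case (Suc n)
      have "(\<Sum>j<Suc n. f (R (2*j+e))) \<le> f (\<Union>j<n. R (2*j+e)) + f (R (2*n+e))"
        using Suc by (auto intro: add_right_mono)
      also have "\<dots> \<le> f ((\<Union>j<n. R (2*j+e)) \<union> R (2*n+e))"
      proof (cases "n = 0")
        case False
        show ?thesis
        proof (rule sep[where d="1 / real (2*n+e) - 1 / real (2*n+e+1)"])
          show "0 < 1 / real (2*n+e) - 1 / real (2*n+e+1)"
            using False by (simp add: frac_less2)
          fix x y assume "x \<in> (\<Union>j<n. R (2*j+e))" and y: "y \<in> R (2*n+e)"
          then obtain j where j: "j < n" "1 / real (2*j+e+2) \<le> infdist x C" by (auto simp: R_def)
          have "1 / real (2*n+e) \<le> 1 / real (2*j+e+2)"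
            using j by (intro divide_left_mono) auto
          moreover have "infdist y C < 1 / real (2*n+e+1)" using y by (auto simp: R_def)
          moreover have "infdist x C \<le> infdist y C + dist x y" by (rule infdist_triangle)
          ultimately show "1 / real (2*n+e) - 1 / real (2*n+e+1) \<le> dist x y" using j by linarith
        qed
      qed (simp add: empty)
      also have "\<dots> = f (\<Union>j<Suc n. R (2*j+e))" by (simp add: lessThan_Suc Un_commute)
      finally show ?case .
    qed (simp add: empty)
    have R_T: "(\<Sum>j<n. f (R (2*j+e))) \<le> f T" for n e
      by (rule order_trans[OF R_sum mono]) (auto simp: R_def)
    have R2: "(\<Sum>j<n. f (R j)) \<le> 2 * f T" for n
    proof -
      have "(\<Sum>j<n. f (R j)) \<le> (\<Sum>j<2*n. f (R j))" by (intro sum_mono2) auto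
      also have "\<dots> = (\<Sum>j<n. f (R (2*j+0))) + (\<Sum>j<n. f (R (2*j+1)))"
        by (induction n) (auto simp: algebra_simps)
      also have "\<dots> \<le> f T + f T" by (intro add_mono R_T)
      finally show ?thesis by (simp add: mult_2)
    qed
    have "(\<Sum>j. f (R j)) \<le> 2 * f T"
      by (intro suminf_le_const summableI R2)
    also have "\<dots> < top" using fin by (simp add: ennreal_mult_less_top)
    finally have sumfin: "(\<Sum>j. f (R j)) < top" .
    have tail: "f (T \<inter> C) + f (T - C) \<le> f T + (\<Sum>j. f (R (j + k)))" for k
    proof -
      define A where "A = {x\<in>T. 1 / real (k+1) \<le> infdist x C}"
      have "T - C \<subseteq> A \<union> (\<Union>j. R (j + k))"
      proof
        fix x assume x: "x \<in> T - C"
        then have pos: "infdist x C > 0"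
          using \<open>closed C\<close> \<open>C \<noteq> {}\<close> infdist_pos_not_in_closed by fastforce
        show "x \<in> A \<union> (\<Union>j. R (j + k))"
        proof (cases "x \<in> A")
          case False
          then have lt: "infdist x C < 1 / real (k+1)" using x by (auto simp: A_def)
          have ex: "\<exists>m. 1 / real (m+1) \<le> infdist x C"
            using pos by (metis Suc_eq_plus1 nat_approx_posE less_imp_le)
          define m where "m = (LEAST m. 1 / real (m+1) \<le> infdist x C)"
          have m: "1 / real (m+1) \<le> infdist x C" unfolding m_def using ex by (rule LeastI_ex)
          have "m > k"
          proof (rule ccontr)
            assume "\<not> m > k"
            then have "1 / real (k+1) \<le> 1 / real (m+1)" by (intro divide_left_mono) auto
            then show False using m lt by linarith
          qed
          then obtain j where j: "m = j + k + 1" by (metis add.commute less_imp_Suc_add Suc_eq_plus1 add.assoc)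
          have "\<not> 1 / real (j+k+1) \<le> infdist x C"
            using not_less_Least[of "j+k" "\<lambda>m. 1 / real (m+1) \<le> infdist x C"] j by (simp add: m_def)
          then have "x \<in> R (j+k)" using m j x by (auto simp: R_def add.commute)
          then show ?thesis by blast
        qed auto
      qed
      then have "f (T - C) \<le> f (A \<union> (\<Union>j. R (j + k)))" by (rule mono)
      also have "\<dots> \<le> f A + (\<Sum>j. f (R (j + k)))"
        by (rule order_trans[OF subadd add_left_mono[OF csub]])
      finally have "f (T \<inter> C) + f (T - C) \<le> (f (T \<inter> C) + f A) + (\<Sum>j. f (R (j + k)))"
        by (metis add_left_mono add.assoc)
      also have "f (T \<inter> C) + f A \<le> f ((T \<inter> C) \<union> A)"
      proof (rule sep[where d="1 / real (k+1)"])
        fix x y assume "x \<in> T \<inter> C" "y \<in> A"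
        then show "1 / real (k+1) \<le> dist x y"
          using infdist_le[of x C y] by (auto simp: A_def dist_commute)
      qed auto
      also have "\<dots> \<le> f T" by (rule mono) (auto simp: A_def)
      finally show ?thesis by (simp add: add_right_mono)
    qed
    have "(\<Sum>j. f (R j)) + (f (T \<inter> C) + f (T - C)) \<le> f T + (\<Sum>j. f (R j))"
    proof (rule ennreal_suminf_bound_add)
      fix k
      have "(\<Sum>j<k. f (R j)) + (f (T \<inter> C) + f (T - C)) \<le>
          (\<Sum>j<k. f (R j)) + (f T + (\<Sum>j. f (R (j + k))))"
        by (intro add_left_mono tail)
      also have "\<dots> = f T + ((\<Sum>j. f (R (j + k))) + (\<Sum>j<k. f (R j)))"
        by (simp add: ac_simps)
      also have "(\<Sum>j. f (R (j + k))) + (\<Sum>j<k. f (R j)) = (\<Sum>j. f (R j))"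
        by (rule suminf_offset[symmetric]) auto
      finally show "(\<Sum>j<k. f (R j)) + (f (T \<inter> C) + f (T - C)) \<le> f T + (\<Sum>j. f (R j))" .
    qed
    then show ?thesis using sumfin
      by (auto simp: add.commute[of "f T"] less_top)
  qed
  have "f (T \<inter> C) + f (T - C) = f T" for T
    using main[of T] subadd[of "T \<inter> C" "T - C"] by (simp add: Int_Diff_Un antisym)
  then show ?thesis by (subst lambda_system_eq) auto
qed

text \<open>
  \<^const>\<open>measure_of\<close> yields the zero measure unless the given set function is countably additive. That it is follows because the
  Caratheodory measurable sets contain all closed sets.
\<close>

lemma emeasure_hausdorff_measure:
  fixes A :: "'a::metric_space set"
  assumes "A \<in> sets borel"
  shows "emeasure (hausdorff_measure s) A = hausdorff_outer s A"
proof -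
  let ?f = "hausdorff_outer s :: 'a set \<Rightarrow> ennreal"
  let ?L = "lambda_system UNIV (Pow UNIV) ?f"
  have L: "measure_space UNIV ?L ?f"
    by (rule sigma_algebra.caratheodory_lemma[OF sigma_algebra_Pow outer_measure_space_hausdorff])
  have closed_L: "Collect closed \<subseteq> ?L"
  proof
    fix C :: "'a set" assume "C \<in> Collect closed"
    then have "closed C" by simp
    with outer_measure_space_hausdorff hausdorff_outer_separated show "C \<in> ?L"
      by (rule closed_in_lambda_system)
  qed
  have "sets (borel :: 'a measure) = sigma_sets UNIV (Collect closed)"
    by (subst borel_eq_closed) simp
  also have "\<dots> \<subseteq> ?L"
    using L closed_L by (intro sigma_algebra.sigma_sets_subset) (auto simp: measure_space_def)
  finally have "sets (borel :: 'a measure) \<subseteq> ?L" .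
  moreover have sa: "sigma_algebra UNIV (sets (borel :: 'a measure))"
    using sets.sigma_algebra_axioms[of "borel :: 'a measure"] by simp
  ultimately have "measure_space UNIV (sets borel) ?f"
    using L measure_down by blast
  then show ?thesis
    unfolding hausdorff_measure_def measure_space_def using assms
    by (intro emeasure_measure_of_sigma) auto
qed

lemma hausdorff_outer_lipschitz_le:
  fixes f :: "'a::metric_space \<Rightarrow> 'b::metric_space"
  assumes "r > 0" and f: "\<And>x y. dist (f x) (f y) \<le> r * dist x y"  and "s \<ge> 0"
  shows "hausdorff_outer s (f ` A) \<le> ennreal (r powr s) * hausdorff_outer s A"
  unfolding hausdorff_outer_def[of s "f ` A"]
proof (rule SUP_least)
  fix \<delta> :: real assume "\<delta> \<in> {0<..}"
  then have "\<delta> > 0" by simp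
  have img: "bounded (f ` S) \<and> diameter (f ` S) \<le> r * diameter S" if "bounded S" for S
  proof -
    have d: "dist (f x) (f y) \<le> r * diameter S" if "x \<in> S" "y \<in> S" for x y
      using f[of x y] diameter_bounded_bound[OF \<open>bounded S\<close> that] \<open>r > 0\<close>
      by (meson mult_left_mono less_imp_le order_trans)
    then have "bounded (f ` S)" unfolding bounded_two_points by blast
    moreover have "diameter (f ` S) \<le> r * diameter S"
    proof (cases "S = {}")
      case False
      then show ?thesis unfolding diameter_def[of "f ` S"]
        using d by (auto intro!: cSUP_least)
    qed simp
    ultimately show ?thesis ..
  qed
  have "hausdorff_pre s \<delta> (f ` A) \<le> ennreal (r powr s) * hausdorff_pre s (\<delta> / r) A"
  proof (cases "hausdorff_pre s (\<delta> / r) A = top")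
    case True
    then show ?thesis using \<open>r > 0\<close> by (simp add: ennreal_mult_top)
  next
    case False
    show ?thesis
    proof (rule ennreal_le_epsilon)
      fix e :: real assume "0 < e"
      define e' where "e' = e / (r powr s)"
      have "e' > 0" using \<open>0 < e\<close> \<open>r > 0\<close> by (simp add: e'_def)
      then have "hausdorff_pre s (\<delta> / r) A < hausdorff_pre s (\<delta> / r) A + ennreal e'"
        using False by (simp add: ennreal_add_left_cancel_less less_top)
      then obtain U where U: "A \<subseteq> (\<Union>i. U i)" "\<And>i. bounded (U i)"
        "\<And>i. diameter (U i) \<le> \<delta> / r"
        and sm: "(\<Sum>i. ennreal (diameter (U i) powr s)) < hausdorff_pre s (\<delta> / r) A + ennreal e'"
        by (rule hausdorff_pre_close) (rule that)
      have "hausdorff_pre s \<delta> (f ` A) \<le> (\<Sum>i. ennreal (diameter (f ` U i) powr s))"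
      proof (rule hausdorff_pre_le)
        show "f ` A \<subseteq> (\<Union>i. f ` U i)" using U(1) by blast
        show "diameter (f ` U i) \<le> \<delta>" for i
          using img[OF U(2)[of i]] U(3)[of i] \<open>r > 0\<close> by (auto simp: field_simps)
        show "bounded (f ` U i)" for i using img[OF U(2)[of i]] ..
      qed
      also have "\<dots> \<le> (\<Sum>i. ennreal (r powr s) * ennreal (diameter (U i) powr s))"
      proof (intro suminf_le allI)
        fix i
        have "diameter (f ` U i) powr s \<le> (r * diameter (U i)) powr s"
          using img[OF U(2)[of i]] \<open>s \<ge> 0\<close> by (intro powr_mono2) (auto intro: diameter_ge_0)
        also have "\<dots> = r powr s * diameter (U i) powr s"
          using \<open>r > 0\<close> diameter_ge_0[OF U(2)] by (simp add: powr_mult)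
        finally show "ennreal (diameter (f ` U i) powr s) \<le> ennreal (r powr s) * ennreal (diameter (U i) powr s)"
          by (simp add: ennreal_mult' [symmetric] ennreal_leI)
      qed auto
      also have "\<dots> = ennreal (r powr s) * (\<Sum>i. ennreal (diameter (U i) powr s))" by simp
      also have "\<dots> \<le> ennreal (r powr s) * (hausdorff_pre s (\<delta> / r) A + ennreal e')"
        using sm by (intro mult_left_mono) auto
      also have "\<dots> = ennreal (r powr s) * hausdorff_pre s (\<delta> / r) A + e"
        using \<open>e' > 0\<close> \<open>r > 0\<close> by (simp add: distrib_left ennreal_mult'[symmetric] e'_def)
      finally show "hausdorff_pre s \<delta> (f ` A) \<le> ennreal (r powr s) * hausdorff_pre s (\<delta> / r) A + e" .
    qed
  qed
  also have "\<dots> \<le> ennreal (r powr s) * hausdorff_outer s A"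
    using \<open>\<delta> > 0\<close> \<open>r > 0\<close> by (intro mult_left_mono hausdorff_pre_le_outer) auto
  finally show "hausdorff_pre s \<delta> (f ` A) \<le> ennreal (r powr s) * hausdorff_outer s A" .
qed

section \<open>Words and cell maps\<close>

lemma finite_words: "finite (words n)"
proof -
  have "words n = {w. set w \<subseteq> {..<8} \<and> length w = n}" by (auto simp: words_def)
  then show ?thesis by (simp add: finite_lists_length_eq)
qed

lemma words_0 [simp]: "words 0 = {[]}"
  by (auto simp: words_def)

lemma Nil_in_words [simp]: "[] \<in> words n \<longleftrightarrow> n = 0"
  by (auto simp: words_def)

lemma length_words: "w \<in> words n \<Longrightarrow> length w = n"
  by (auto simp: words_def)

lemma append_in_words: "v \<in> words m \<Longrightarrow> w \<in> words n \<Longrightarrow> v @ w \<in> words (m + n)"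
  by (auto simp: words_def)

lemma snoc_in_words: "w \<in> words n \<Longrightarrow> i < 8 \<Longrightarrow> w @ [i] \<in> words (Suc n)"
  by (auto simp: words_def)

lemma Cons_in_words_iff: "i # w \<in> words (Suc n) \<longleftrightarrow> i < 8 \<and> w \<in> words n"
  by (auto simp: words_def)

lemma append_replicate_in_words: "w \<in> words n \<Longrightarrow> i < 8 \<Longrightarrow> w @ replicate l i \<in> words (n + l)"
  by (auto simp: words_def)

lemma sum_words_append:
  "(\<Sum>w\<in>words (m + n). f w) = (\<Sum>v\<in>words m. \<Sum>w\<in>words n. f (v @ w))"
proof -
  have "(\<Sum>(v,w)\<in>words m \<times> words n. f (v @ w)) = (\<Sum>w\<in>words (m + n). f w)"
  proof (rule sum.reindex_bij_witness[where i="\<lambda>w. (take m w, drop m w)" and j="\<lambda>(v,w). v @ w"])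
    fix w assume "w \<in> words (m + n)"
    then show "(take m w, drop m w) \<in> words m \<times> words n"
      by (auto simp: words_def dest: in_set_takeD in_set_dropD)
  qed (auto simp: append_in_words length_words)
  then show ?thesis by (simp add: sum.cartesian_product)
qed

lemma sum_words_1: "(\<Sum>w\<in>words (Suc 0). f w) = (\<Sum>i<8. f [i])"
  by (rule sum.reindex_bij_witness[where i="\<lambda>i. [i]" and j=hd])
     (auto simp: words_def length_Suc_conv)

lemma sum_words_Suc: "(\<Sum>w\<in>words (Suc n). f w) = (\<Sum>w\<in>words n. \<Sum>i<8. f (w @ [i]))"
  using sum_words_append[of f n "Suc 0"] by (simp add: sum_words_1)

lemma sum_words_Suc': "(\<Sum>w\<in>words (Suc n). f w) = (\<Sum>i<8. \<Sum>w\<in>words n. f (i # w))"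
  using sum_words_append[of f "Suc 0" n] by (simp add: sum_words_1)

lemma card_words: "card (words n) = 8 ^ n"
proof (induction n)
  case (Suc n)
  have "card (words (Suc n)) = (\<Sum>w\<in>words (Suc n). 1)" by simp
  also have "\<dots> = 8 * card (words n)" by (subst sum_words_Suc) simp
  finally show ?case using Suc by simp
qed simp

lemma word_map_Nil [simp]: "word_map [] x = x"
  by (simp add: word_map_def)

lemma word_map_Cons: "word_map (i # w) x = carpet_map i (word_map w x)"
  by (simp add: word_map_def)

lemma word_map_append: "word_map (v @ w) x = word_map v (word_map w x)"
  by (induction v) (auto simp: word_map_Cons)

lemma word_map_single [simp]: "word_map [i] x = carpet_map i x"
  by (simp add: word_map_Cons)

lemma word_map_diff: "word_map w x - word_map w y = (1 / 3 ^ length w) *\<^sub>R (x - y)"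
proof (induction w)
  case (Cons i w)
  have "word_map (i # w) x - word_map (i # w) y = (1/3) *\<^sub>R (word_map w x - word_map w y)"
    by (simp add: word_map_Cons carpet_map_def algebra_simps)
  then show ?case using Cons by simp
qed simp

lemma dist_word_map: "dist (word_map w x) (word_map w y) = dist x y / 3 ^ length w"
  by (simp add: dist_norm word_map_diff)

lemma continuous_on_word_map: "continuous_on S (word_map w)"
proof (rule uniformly_continuous_imp_continuous[OF lipschitz_on_uniformly_continuous])
  show "(1 / 3 ^ length w)-lipschitz_on S (word_map w)"
    by (rule lipschitz_onI) (auto simp: dist_word_map)
qed

lemma carpet_map_carpet_pt [simp]: "carpet_map i (carpet_pt i) = carpet_pt i"
  by (simp add: carpet_map_def scaleR_2[symmetric] vec_eq_iff)

lemma word_map_replicate [simp]: "word_map (replicate l i) (carpet_pt i) = carpet_pt i"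
  by (induction l) (auto simp: word_map_Cons)

text \<open>
  The coordinates of the eight points, doubled to become the base-3 digits 0, 1, 2.
\<close>

definition pt_col :: "nat \<Rightarrow> int" where
  "pt_col i = [0, 1, 2, 2, 2, 1, 0, 0] ! i"

definition pt_row :: "nat \<Rightarrow> int" where
  "pt_row i = [0, 0, 0, 1, 2, 2, 2, 1] ! i"

lemma less_8: "i < (8::nat) \<longleftrightarrow> i = 0 \<or> i = 1 \<or> i = 2 \<or> i = 3 \<or> i = 4 \<or> i = 5 \<or> i = 6 \<or> i = 7"
  by auto

lemma carpet_pt_coords:
  assumes "i < 8"
  shows "carpet_pt i $ 1 = pt_col i / 2" "carpet_pt i $ 2 = pt_row i / 2"
  using assms by (auto simp: less_8 carpet_pt_def pt_col_def pt_row_def)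

lemma pt_bounds:
  assumes "i < 8"
  shows "0 \<le> pt_col i" "pt_col i \<le> 2" "0 \<le> pt_row i" "pt_row i \<le> 2"
  using assms by (auto simp: less_8 pt_col_def pt_row_def)

lemma pt_inj: "i < 8 \<Longrightarrow> k < 8 \<Longrightarrow> pt_col i = pt_col k \<Longrightarrow> pt_row i = pt_row k \<Longrightarrow> i = k"
  by (auto simp: less_8 pt_col_def pt_row_def)

lemma vec2_eq_iff: "x = y \<longleftrightarrow> x $ 1 = y $ 1 \<and> x $ 2 = (y :: 'a^2) $ 2"
  by (auto simp: vec_eq_iff forall_2)

lemma dist_le_coords: "dist x y \<le> \<bar>x $ 1 - y $ 1\<bar> + \<bar>x $ 2 - (y :: real^2) $ 2\<bar>"
  using norm_le_l1_cart[of "x - y"] by (simp add: dist_norm sum_2)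

lemma coord_le_dist: "\<bar>x $ i - y $ i\<bar> \<le> dist x (y :: real^2)"
  using component_le_norm_cart[of "x - y" i] by (simp add: dist_norm)

section \<open>Existence and uniqueness of the carpet\<close>

definition unit_square :: "(real^2) set" where
  "unit_square = {x. 0 \<le> x $ 1 \<and> x $ 1 \<le> 1 \<and> 0 \<le> x $ 2 \<and> x $ 2 \<le> 1}"

lemma closed_unit_square: "closed unit_square"
  unfolding unit_square_def by (intro closed_Collect_conj closed_Collect_le continuous_intros)

lemma unit_square_dist: "x \<in> unit_square \<Longrightarrow> y \<in> unit_square \<Longrightarrow> dist x y \<le> 2"
  by (rule order_trans[OF dist_le_coords]) (auto simp: unit_square_def abs_le_iff)

lemma carpet_pt_in_square: "i < 8 \<Longrightarrow> carpet_pt i \<in> unit_square"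
  using pt_bounds[of i] by (auto simp: unit_square_def carpet_pt_coords)

lemma carpet_map_in_square: "i < 8 \<Longrightarrow> x \<in> unit_square \<Longrightarrow> carpet_map i x \<in> unit_square"
  using carpet_pt_in_square[of i] by (auto simp: unit_square_def carpet_map_def)

text \<open>
  The orbit \<open>S\<close> of the eight points under all cell maps satisfies \<open>S = (\<Union>i<8. carpet_map i ` S)\<close>, since each
  \<^term>\<open>carpet_pt i\<close> is fixed by \<^term>\<open>carpet_map i\<close>. Its closure inherits this equation and is compact.
\<close>

lemma carpet_exists:
  "\<exists>K. compact K \<and> K \<noteq> {} \<and> K = (\<Union>i<8. carpet_map i ` K) \<and> K \<subseteq> unit_square"
proof -
  define S where "S = (\<Union>n. \<Union>w\<in>words n. \<Union>k<8. {word_map w (carpet_pt k)})"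
  have S_pt: "carpet_pt k \<in> S" if "k < 8" for k
    unfolding S_def using that by (auto intro!: exI[of _ 0] bexI[of _ k])
  have S_map: "carpet_map i x \<in> S" if "i < 8" "x \<in> S" for i x
  proof -
    obtain n w k where "w \<in> words n" "k < 8" "x = word_map w (carpet_pt k)"
      using \<open>x \<in> S\<close> by (auto simp: S_def)
    then have "i # w \<in> words (Suc n)" "carpet_map i x = word_map (i # w) (carpet_pt k)"
      using that by (auto simp: Cons_in_words_iff word_map_Cons)
    then show ?thesis unfolding S_def using \<open>k < 8\<close> by blast
  qed
  have S_sub: "S \<subseteq> (\<Union>i<8. carpet_map i ` S)"
  proof
    fix x assume "x \<in> S"
    then obtain n w k where x: "w \<in> words n" "k < 8" "x = word_map w (carpet_pt k)"
      by (auto simp: S_def)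
    show "x \<in> (\<Union>i<8. carpet_map i ` S)"
    proof (cases n)
      case 0
      then have "x = carpet_map k (carpet_pt k)" using x by auto
      then show ?thesis using x S_pt by blast
    next
      case (Suc m)
      then obtain i v where w: "w = i # v" using x by (cases w) auto
      then have "i < 8" "v \<in> words m" using x Suc by (auto simp: Cons_in_words_iff)
      then have "word_map v (carpet_pt k) \<in> S" using x by (auto simp: S_def)
      then show ?thesis using \<open>i < 8\<close> x w by (auto simp: word_map_Cons)
    qed
  qed
  have S_sq: "S \<subseteq> unit_square"
  proof -
    have "word_map w x \<in> unit_square" if "set w \<subseteq> {..<8}" "x \<in> unit_square" for w x
      using that by (induction w) (auto simp: word_map_Cons carpet_map_in_square)
    then show ?thesis by (auto simp: S_def words_def carpet_pt_in_square)
  qed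
  have bdd: "bounded unit_square"
    unfolding bounded_two_points using unit_square_dist by blast
  let ?K = "closure S"
  have sq: "?K \<subseteq> unit_square" by (rule closure_minimal[OF S_sq closed_unit_square])
  then have comp: "compact ?K"
    using bdd bounded_subset compact_eq_bounded_closed by blast
  have cont: "continuous_on A (carpet_map i)" for A i
    using continuous_on_word_map[of A "[i]"] by (simp cong: continuous_on_cong)
  have "?K = (\<Union>i<8. carpet_map i ` ?K)"
  proof
    have "closed (\<Union>i<8. carpet_map i ` ?K)"
      by (intro compact_imp_closed compact_UN compact_continuous_image cont comp) auto
    moreover have "S \<subseteq> (\<Union>i<8. carpet_map i ` ?K)"
      using S_sub closure_subset by blast
    ultimately show "?K \<subseteq> (\<Union>i<8. carpet_map i ` ?K)" by (rule closure_minimal[rotated])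
    have "carpet_map i ` ?K \<subseteq> ?K" if "i < 8" for i
    proof (rule image_closure_subset[OF cont closed_closure])
      have "carpet_map i ` S \<subseteq> S" using that S_map by auto
      then show "carpet_map i ` S \<subseteq> ?K" using closure_subset[of S] by (rule order_trans)
    qed
    then show "(\<Union>i<8. carpet_map i ` ?K) \<subseteq> ?K" by blast
  qed
  moreover have "?K \<noteq> {}" using S_pt[of 0] by auto
  ultimately show ?thesis using comp sq by blast
qed

lemma self_similar_words:
  assumes "K = (\<Union>i<8. carpet_map i ` K)"
  shows "K = (\<Union>w\<in>words n. word_map w ` K)"
proof (induction n)
  case (Suc n)
  have "(\<Union>w\<in>words (Suc n). word_map w ` K) = (\<Union>i<8. carpet_map i ` (\<Union>w\<in>words n. word_map w ` K))"
  proof (intro equalityI subsetI)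
    fix x assume "x \<in> (\<Union>w\<in>words (Suc n). word_map w ` K)"
    then obtain w y where w: "w \<in> words (Suc n)" "y \<in> K" "x = word_map w y" by auto
    then obtain i v where "w = i # v" by (cases w) auto
    with w show "x \<in> (\<Union>i<8. carpet_map i ` (\<Union>w\<in>words n. word_map w ` K))"
      by (auto simp: Cons_in_words_iff word_map_Cons)
  next
    fix x assume "x \<in> (\<Union>i<8. carpet_map i ` (\<Union>w\<in>words n. word_map w ` K))"
    then obtain i v y where "i < 8" "v \<in> words n" "y \<in> K" "x = carpet_map i (word_map v y)" by auto
    then show "x \<in> (\<Union>w\<in>words (Suc n). word_map w ` K)"
      by (intro UN_I[of "i # v"]) (auto simp: Cons_in_words_iff word_map_Cons)
  qed
  then show ?case using Suc assms by simp
qed simp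

text \<open>
  A point of \<open>K\<close> lies in the \<open>word_map w\<close>-image of \<open>K\<close> for words \<open>w\<close> of any length, and this image is close to the
  \<open>word_map w\<close>-image of \<open>K'\<close>, because \<open>word_map w\<close> contracts by \<open>3 ^ length w\<close>. Applied in both directions it shows that the
  carpet is unique.
\<close>

lemma self_similar_subset:
  assumes K: "compact K" "K = (\<Union>i<8. carpet_map i ` K)"
    and K': "compact K'" "K' \<noteq> {}" "K' = (\<Union>i<8. carpet_map i ` K')"
  shows "K \<subseteq> K'"
proof
  fix x assume "x \<in> K"
  obtain y where y: "y \<in> K'" using K' by auto
  have "bounded (K \<union> K')" using K K' by (simp add: compact_imp_bounded)
  then obtain D where D: "\<And>a b. a \<in> K \<Longrightarrow> b \<in> K' \<Longrightarrow> dist a b \<le> D"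
    unfolding bounded_two_points by blast
  have "\<exists>z\<in>K'. dist z x < e" if "e > 0" for e
  proof -
    have "(\<lambda>n. D * (1/3) ^ n) \<longlonglongrightarrow> D * 0" by (intro tendsto_mult_left LIMSEQ_power_zero) auto
    then have "\<forall>\<^sub>F n in sequentially. D * (1/3) ^ n < e" using that by (auto dest: order_tendstoD)
    then obtain n where n: "D * (1/3) ^ n < e" by (auto simp: eventually_sequentially)
    have "x \<in> (\<Union>w\<in>words n. word_map w ` K)"
      using self_similar_words[OF K(2), of n] \<open>x \<in> K\<close> by blast
    then obtain w a where w: "w \<in> words n" "a \<in> K" "x = word_map w a" by blast
    have "word_map w y \<in> K'" using self_similar_words[OF K'(3), of n] w(1) y by blast
    moreover have "dist (word_map w y) x \<le> D * (1/3) ^ n"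
      using D[OF w(2) y] w by (simp add: dist_word_map length_words dist_commute power_divide divide_right_mono)
    ultimately show ?thesis using n by force
  qed
  then show "x \<in> K'" using closed_approachable[OF compact_imp_closed[OF K'(1)]] by blast
qed

lemma carpet_props:
  "compact carpet" "carpet \<noteq> {}" "carpet = (\<Union>i<8. carpet_map i ` carpet)" "carpet \<subseteq> unit_square"
proof -
  obtain K where K: "compact K" "K \<noteq> {}" "K = (\<Union>i<8. carpet_map i ` K)" "K \<subseteq> unit_square"
    using carpet_exists by auto
  have "carpet = K" unfolding carpet_def
  proof (rule the_equality)
    fix L assume "compact L \<and> L \<noteq> {} \<and> L = (\<Union>i<8. carpet_map i ` L)"
    then show "L = K" using self_similar_subset[of K L] self_similar_subset[of L K] K by blast
  qed (use K in blast)
  then show "compact carpet" "carpet \<noteq> {}" "carpet = (\<Union>i<8. carpet_map i ` carpet)" "carpet \<subseteq> unit_square"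
    using K by auto
qed

section \<open>Cells and their lattice coordinates\<close>

definition cell :: "nat list \<Rightarrow> (real^2) set" where
  "cell w = word_map w ` carpet"

lemma carpet_cells: "carpet = (\<Union>w\<in>words n. cell w)"
  unfolding cell_def by (rule self_similar_words[OF carpet_props(3)])

lemma cell_append: "cell (v @ w) = word_map v ` cell w"
  unfolding cell_def by (auto simp: word_map_append image_image)

lemma cell_cells: "cell w = (\<Union>v\<in>words n. cell (w @ v))"
  unfolding cell_append by (subst cell_def, subst carpet_cells[of n]) auto

lemma cell_subset_carpet: "w \<in> words n \<Longrightarrow> cell w \<subseteq> carpet"
  using carpet_cells[of n] by blast

lemma cell_append_subset: "v \<in> words n \<Longrightarrow> cell (w @ v) \<subseteq> cell w"
  using cell_cells[of w n] by blast

lemma compact_cell: "compact (cell w)"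
  unfolding cell_def by (intro compact_continuous_image continuous_on_word_map carpet_props)

lemma cell_Nil [simp]: "cell [] = carpet"
  by (auto simp: cell_def)

lemma cell_dist: "x \<in> cell w \<Longrightarrow> y \<in> cell w \<Longrightarrow> dist x y \<le> 2 / 3 ^ length w"
  using unit_square_dist carpet_props(4)
  by (auto simp: cell_def dist_word_map subset_iff intro!: divide_right_mono)

text \<open>
  \<open>carpet_pt k\<close> is the limit of the images of any point of the carpet under iteration of \<open>carpet_map k\<close>.
\<close>

lemma carpet_pt_in_carpet:
  assumes "k < 8"
  shows "carpet_pt k \<in> carpet"
proof -
  obtain x where x: "x \<in> carpet" using carpet_props by auto
  have mem: "word_map (replicate l k) x \<in> carpet" for l
  proof -
    have "replicate l k \<in> words l" using assms by (auto simp: words_def)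
    from cell_subset_carpet[OF this] show ?thesis using x by (auto simp: cell_def)
  qed
  have "(\<lambda>l. dist x (carpet_pt k) * (1/3) ^ l) \<longlonglongrightarrow> dist x (carpet_pt k) * 0"
    by (intro tendsto_mult_left LIMSEQ_power_zero) auto
  moreover have "dist (word_map (replicate l k) x) (carpet_pt k) = dist x (carpet_pt k) * (1/3) ^ l" for l
    using dist_word_map[of "replicate l k" x "carpet_pt k"] by (simp add: power_divide)
  ultimately have "(\<lambda>l. word_map (replicate l k) x) \<longlonglongrightarrow> carpet_pt k"
    by (subst tendsto_dist_iff) simp
  then show ?thesis
    by (rule closed_sequentially[OF compact_imp_closed[OF carpet_props(1)] mem])
qed

lemma vertex_in_cell: "k < 8 \<Longrightarrow> word_map w (carpet_pt k) \<in> cell w"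
  by (auto simp: cell_def carpet_pt_in_carpet)

text \<open>
  The cell of a word \<open>w\<close> of length \<open>n\<close> lies in the closed square of side length \<open>1/3^n\<close> with lower left corner
  \<open>(cell_col w / 3^n, cell_row w / 3^n)\<close>. These integer coordinates turn all proximity questions about cells into counting of
  lattice points.
\<close>

fun cell_col :: "nat list \<Rightarrow> int" where
  "cell_col [] = 0"
| "cell_col (i # w) = pt_col i * 3 ^ length w + cell_col w"

fun cell_row :: "nat list \<Rightarrow> int" where
  "cell_row [] = 0"
| "cell_row (i # w) = pt_row i * 3 ^ length w + cell_row w"

lemma word_map_coords:
  assumes "set w \<subseteq> {..<8}"
  shows "word_map w x $ 1 = (x $ 1 + cell_col w) / 3 ^ length w"
        "word_map w x $ 2 = (x $ 2 + cell_row w) / 3 ^ length w"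
  using assms
  by (induction w)
     (auto simp: word_map_Cons carpet_map_def carpet_pt_coords field_simps)

lemma col_row_bounds:
  assumes "set w \<subseteq> {..<8}"
  shows "0 \<le> cell_col w \<and> cell_col w < 3 ^ length w \<and> 0 \<le> cell_row w \<and> cell_row w < 3 ^ length w"
  using assms
proof (induction w)
  case (Cons i w)
  have "i < 8" using Cons by auto
  have "pt_col i * 3 ^ length w \<le> 2 * 3 ^ length w" "pt_row i * 3 ^ length w \<le> 2 * 3 ^ length w"
    "0 \<le> pt_col i * 3 ^ length w" "0 \<le> pt_row i * 3 ^ length w"
    using pt_bounds[OF \<open>i < 8\<close>] by (auto intro: mult_right_mono)
  moreover have "0 \<le> cell_col w \<and> cell_col w < 3 ^ length w \<and> 0 \<le> cell_row w \<and> cell_row w < 3 ^ length w"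
    using Cons by auto
  ultimately show ?case
    unfolding cell_col.simps cell_row.simps length_Cons power_Suc by linarith
qed simp

text \<open>
  The words are read off from the base-3 digits of the coordinates, as the eight pairs of digits \<open>(pt_col i, pt_row i)\<close> are distinct.
\<close>

lemma col_row_inj:
  "w \<in> words n \<Longrightarrow> v \<in> words n \<Longrightarrow> cell_col w = cell_col v \<Longrightarrow> cell_row w = cell_row v \<Longrightarrow> w = v"
proof (induction w arbitrary: v n)
  case (Cons i w)
  from Cons obtain m where n: "n = Suc m" by (cases n) (auto simp: words_def)
  from Cons n obtain k v' where v: "v = k # v'" by (cases v) auto
  have mem: "i < 8" "w \<in> words m" "k < 8" "v' \<in> words m"
    using Cons.prems n v by (auto simp: Cons_in_words_iff)
  have b: "0 \<le> cell_col w" "cell_col w < 3 ^ m" "0 \<le> cell_row w" "cell_row w < 3 ^ m"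
          "0 \<le> cell_col v'" "cell_col v' < 3 ^ m" "0 \<le> cell_row v'" "cell_row v' < 3 ^ m"
    using col_row_bounds[of w] col_row_bounds[of v'] mem by (auto simp: words_def)
  have e: "pt_col i * 3 ^ m + cell_col w = pt_col k * 3 ^ m + cell_col v'"
          "pt_row i * 3 ^ m + cell_row w = pt_row k * 3 ^ m + cell_row v'"
    using Cons.prems v mem by (auto simp: length_words)
  have *: "a = b" if "a * 3 ^ m + c = b * 3 ^ m + d" "0 \<le> c" "c < 3 ^ m" "0 \<le> d" "d < 3 ^ m"
    for a b c d :: int
  proof -
    have "a = (a * 3 ^ m + c) div 3 ^ m" "b = (b * 3 ^ m + d) div 3 ^ m"
      using that(2-5) by auto
    then show ?thesis using that(1) by simp
  qed
  have "pt_col i = pt_col k" "pt_row i = pt_row k" using e b * by metis+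
  then have "i = k" using pt_inj mem by auto
  then show ?case using Cons.IH[of m v'] e mem v by auto
qed (auto simp: words_def)

lemma card_words_near:
  fixes a b k :: int
  assumes "k \<ge> 0"
  shows "card {w\<in>words n. \<bar>cell_col w - a\<bar> \<le> k \<and> \<bar>cell_row w - b\<bar> \<le> k} \<le> (2 * nat k + 1)^2"
proof -
  let ?S = "{w\<in>words n. \<bar>cell_col w - a\<bar> \<le> k \<and> \<bar>cell_row w - b\<bar> \<le> k}"
  have "card ?S \<le> card ({a-k..a+k} \<times> {b-k..b+k})"
  proof (rule card_inj_on_le)
    show "inj_on (\<lambda>w. (cell_col w, cell_row w)) ?S" by (auto intro!: inj_onI intro: col_row_inj)
    show "(\<lambda>w. (cell_col w, cell_row w)) ` ?S \<subseteq> {a-k..a+k} \<times> {b-k..b+k}" by auto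
  qed auto
  also have "\<dots> = (2 * nat k + 1)^2" using assms
    by (simp add: card_cartesian_product power2_eq_square nat_add_distrib nat_mult_distrib)
  finally show ?thesis .
qed

text \<open>
  The squares of two cells of the same level meet, possibly in a corner only.
\<close>

definition touching :: "nat list \<Rightarrow> nat list \<Rightarrow> bool" where
  "touching w v \<longleftrightarrow> \<bar>cell_col v - cell_col w\<bar> \<le> 1 \<and> \<bar>cell_row v - cell_row w\<bar> \<le> 1"

lemma touching_sym: "touching w v \<longleftrightarrow> touching v w"
  by (auto simp: touching_def abs_minus_commute)

lemma card_touching: "card {v\<in>words n. touching w v} \<le> 9"
  using card_words_near[of 1 n "cell_col w" "cell_row w"] by (simp add: touching_def)

lemma cell_coords:
  assumes "w \<in> words n" "x \<in> cell w"
  shows "cell_col w \<le> 3 ^ n * x $ 1" "3 ^ n * x $ 1 \<le> cell_col w + 1"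
        "cell_row w \<le> 3 ^ n * x $ 2" "3 ^ n * x $ 2 \<le> cell_row w + 1"
proof -
  obtain y where y: "y \<in> carpet" "x = word_map w y" using assms by (auto simp: cell_def)
  have "y \<in> unit_square" using y carpet_props by auto
  moreover have "3 ^ n * x $ 1 = y $ 1 + cell_col w" "3 ^ n * x $ 2 = y $ 2 + cell_row w"
    using assms y word_map_coords[of w y] by (auto simp: words_def)
  ultimately show "cell_col w \<le> 3 ^ n * x $ 1" "3 ^ n * x $ 1 \<le> cell_col w + 1"
        "cell_row w \<le> 3 ^ n * x $ 2" "3 ^ n * x $ 2 \<le> cell_row w + 1"
    by (auto simp: unit_square_def)
qed

text \<open>
  The strict bound by the side length of a cell is essential: it forces the coordinates of the two cells to differ by less than 2,
  hence by at most 1.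
\<close>

lemma near_cells_touch:
  assumes "w \<in> words n" "v \<in> words n" "x \<in> cell w" "y \<in> cell v" "dist x y < 1 / 3 ^ n"
  shows "touching w v"
proof -
  have d: "\<bar>3 ^ n * x $ i - 3 ^ n * y $ i\<bar> < 1" for i
  proof -
    have "\<bar>3 ^ n * x $ i - 3 ^ n * y $ i\<bar> = 3 ^ n * \<bar>x $ i - y $ i\<bar>"
      by (simp add: abs_mult right_diff_distrib[symmetric])
    also have "\<dots> \<le> 3 ^ n * dist x y" by (intro mult_left_mono coord_le_dist) auto
    also have "\<dots> < 1" using assms(5) by (simp add: field_simps)
    finally show ?thesis .
  qed
  have "\<bar>real_of_int (cell_col v) - cell_col w\<bar> < 2" "\<bar>real_of_int (cell_row v) - cell_row w\<bar> < 2"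
    using d[of 1] d[of 2] cell_coords[OF assms(1,3)] cell_coords[OF assms(2,4)] by linarith+
  then have "\<bar>cell_col v - cell_col w\<bar> < 2" "\<bar>cell_row v - cell_row w\<bar> < 2" by linarith+
  then show ?thesis by (auto simp: touching_def)
qed

text \<open>
  After scaling by \<open>3^n\<close>, each coordinate of such a cell lies strictly between \<open>t - 3\<close> and \<open>t + 2\<close> for the scaled coordinate
  \<open>t\<close> of \<open>u\<close>, which leaves 5 integers.
\<close>

lemma card_cells_near_point:
  "card {w\<in>words n. \<exists>y\<in>cell w. dist u y < 2 / 3 ^ n} \<le> 25"
proof -
  have "{w\<in>words n. \<exists>y\<in>cell w. dist u y < 2 / 3 ^ n} \<subseteq>
    {w\<in>words n. \<bar>cell_col w - \<lfloor>3 ^ n * u $ 1\<rfloor>\<bar> \<le> 2 \<and> \<bar>cell_row w - \<lfloor>3 ^ n * u $ 2\<rfloor>\<bar> \<le> 2}"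
  proof (clarify, intro conjI)
    fix w y assume w: "w \<in> words n" "y \<in> cell w" and d: "dist u y < 2 / 3 ^ n"
    have d: "\<bar>3 ^ n * u $ i - 3 ^ n * y $ i\<bar> < 2" for i
    proof -
      have "\<bar>3 ^ n * u $ i - 3 ^ n * y $ i\<bar> = 3 ^ n * \<bar>u $ i - y $ i\<bar>"
        by (simp add: abs_mult right_diff_distrib[symmetric])
      also have "\<dots> \<le> 3 ^ n * dist u y" by (intro mult_left_mono coord_le_dist) auto
      also have "\<dots> < 2" using d by (simp add: field_simps)
      finally show ?thesis .
    qed
    show "\<bar>cell_col w - \<lfloor>3 ^ n * u $ 1\<rfloor>\<bar> \<le> 2"
      using d[of 1] cell_coords[OF w] by linarith
    show "\<bar>cell_row w - \<lfloor>3 ^ n * u $ 2\<rfloor>\<bar> \<le> 2"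
      using d[of 2] cell_coords[OF w] by linarith
  qed
  then have "card {w\<in>words n. \<exists>y\<in>cell w. dist u y < 2 / 3 ^ n} \<le>
      card {w\<in>words n. \<bar>cell_col w - \<lfloor>3 ^ n * u $ 1\<rfloor>\<bar> \<le> 2 \<and> \<bar>cell_row w - \<lfloor>3 ^ n * u $ 2\<rfloor>\<bar> \<le> 2}"
    by (intro card_mono) (auto simp: finite_words)
  also have "\<dots> \<le> 25"
    using card_words_near[of 2 n "\<lfloor>3 ^ n * u $ 1\<rfloor>" "\<lfloor>3 ^ n * u $ 2\<rfloor>"] by simp
  finally show ?thesis .
qed

lemma card_cells_containing: "card {w\<in>words n. x \<in> cell w} \<le> 25"
proof -
  have "card {w\<in>words n. x \<in> cell w} \<le> card {w\<in>words n. \<exists>y\<in>cell w. dist x y < 2 / 3 ^ n}"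
    by (intro card_mono) (auto simp: finite_words intro!: bexI[of _ x])
  also have "\<dots> \<le> 25" by (rule card_cells_near_point)
  finally show ?thesis .
qed

text \<open>
  Two closed squares of a lattice that meet have a common corner, and the corners of a square are among its eight vertices.
  This is why one intermediate point suffices to compare \<open>u\<close> on two neighbouring cells.
\<close>

lemma touching_share_vertex:
  assumes "w \<in> words n" "v \<in> words n" "touching w v"
  shows "\<exists>i<8. \<exists>k<8. word_map w (carpet_pt i) = word_map v (carpet_pt k)"
proof -
  have ab: "\<exists>a\<in>{0,2}. \<exists>b\<in>{0,2}. a + 2 * c = b + 2 * d" if "\<bar>d - c\<bar> \<le> 1" for c d :: int
  proof -
    have "d - c = -1 \<or> d - c = 0 \<or> d - c = 1" using that by linarith
    then show ?thesis by (auto intro: exI)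
  qed
  have corner: "\<exists>i<8. pt_col i = a \<and> pt_row i = b" if "a \<in> {0,2}" "b \<in> {0,2}" for a b
  proof -
    have "pt_col 0 = 0 \<and> pt_row 0 = 0" "pt_col 2 = 2 \<and> pt_row 2 = 0"
      "pt_col 4 = 2 \<and> pt_row 4 = 2" "pt_col 6 = 0 \<and> pt_row 6 = 2"
      by (auto simp: pt_col_def pt_row_def)
    moreover have "0 < (8::nat)" "2 < (8::nat)" "4 < (8::nat)" "6 < (8::nat)" by auto
    ultimately show ?thesis using that by blast
  qed
  obtain a b where a: "a \<in> {0,2}" "b \<in> {0,2}" "a + 2 * cell_col w = b + 2 * cell_col v"
    using ab assms(3) unfolding touching_def by meson
  obtain c d where c: "c \<in> {0,2}" "d \<in> {0,2}" "c + 2 * cell_row w = d + 2 * cell_row v"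
    using ab assms(3) unfolding touching_def by meson
  obtain i where i: "i < 8" "pt_col i = a" "pt_row i = c" using corner a c by blast
  obtain k where k: "k < 8" "pt_col k = b" "pt_row k = d" using corner a c by blast
  have "real_of_int (a + 2 * cell_col w) = real_of_int (b + 2 * cell_col v)"
       "real_of_int (c + 2 * cell_row w) = real_of_int (d + 2 * cell_row v)"
    using a c by auto
  then have "word_map w (carpet_pt i) = word_map v (carpet_pt k)"
    using assms i k unfolding vec2_eq_iff
    by (auto simp: word_map_coords words_def carpet_pt_coords field_simps)
  then show ?thesis using i k by blast
qed

section \<open>Measure of the cells\<close>

lemma carpet_dim_pos: "carpet_dim > 0"
  by (simp add: carpet_dim_def)

lemma three_powr_carpet_dim: "3 powr carpet_dim = 8"
  by (simp add: carpet_dim_def powr_def)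

lemma power3_powr_carpet_dim: "(3 ^ n) powr carpet_dim = 8 ^ n"
proof -
  have "(3 ^ n :: real) powr carpet_dim = (3 powr carpet_dim) ^ n"
    by (simp add: powr_realpow[symmetric] powr_powr mult.commute)
  then show ?thesis by (simp add: three_powr_carpet_dim)
qed

lemma inverse_power3_powr_carpet_dim: "(1 / 3 ^ n) powr carpet_dim = 1 / 8 ^ n"
  by (simp add: powr_divide power3_powr_carpet_dim)

text \<open>
  The identity that balances the two energies: the kernel at scale \<open>3 ^ -m\<close> is the weight of level \<open>m\<close> in the
  discrete energy times \<open>8 ^ m\<close> for each of the two integrations over a cell.
\<close>

lemma power_weight_eq:
  "(3 powr (carpet_dim + \<beta>)) ^ m = (3 powr (\<beta> - carpet_dim)) ^ m * 64 ^ m"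
proof -
  have "3 powr (carpet_dim + \<beta>) = 3 powr (\<beta> - carpet_dim) * (3 powr carpet_dim * 3 powr carpet_dim)"
    by (simp add: powr_add[symmetric])
  then show ?thesis by (simp add: three_powr_carpet_dim power_mult_distrib)
qed

abbreviation carpet_outer :: "(real^2) set \<Rightarrow> ennreal" where
  "carpet_outer \<equiv> hausdorff_outer carpet_dim"

text \<open>
  A cell and the carpet are images of each other under Lipschitz maps with constants \<open>1/3^n\<close> and \<open>3^n\<close>, and
  \<open>3 powr carpet_dim = 8\<close>.
\<close>

lemma carpet_outer_cell:
  assumes "w \<in> words n"
  shows "carpet_outer (cell w) = ennreal (1 / 8 ^ n) * carpet_outer carpet"
proof (rule antisym)
  show "carpet_outer (cell w) \<le> ennreal (1 / 8 ^ n) * carpet_outer carpet"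
    using hausdorff_outer_lipschitz_le[of "1 / 3 ^ n" "word_map w" carpet_dim carpet] carpet_dim_pos assms
    by (simp add: dist_word_map length_words inverse_power3_powr_carpet_dim cell_def)
  \<comment> \<open>The inverse of the cell map.\<close>
  define g where "g x = 3 ^ n *\<^sub>R (x - word_map w 0)" for x
  have g: "g (word_map w x) = x" for x
    using word_map_diff[of w x 0] assms by (simp add: g_def length_words)
  have gd: "dist (g x) (g y) \<le> 3 ^ n * dist x y" for x y
    by (simp add: g_def dist_norm scaleR_diff_right[symmetric])
  have "carpet = g ` cell w" by (simp add: cell_def image_image g)
  then have "carpet_outer carpet \<le> ennreal (8 ^ n) * carpet_outer (cell w)"
    using hausdorff_outer_lipschitz_le[of "3 ^ n" g carpet_dim "cell w"] carpet_dim_pos gd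
    by (simp add: power3_powr_carpet_dim)
  then have "ennreal (1 / 8 ^ n) * carpet_outer carpet \<le> ennreal (1 / 8 ^ n) * (ennreal (8 ^ n) * carpet_outer (cell w))"
    by (rule mult_left_mono) simp
  also have "\<dots> = carpet_outer (cell w)"
    by (simp add: mult.assoc[symmetric] ennreal_mult'[symmetric])
  finally show "ennreal (1 / 8 ^ n) * carpet_outer carpet \<le> carpet_outer (cell w)" .
qed

text \<open>
  The \<open>8^n\<close> cells of level \<open>n\<close> cover the carpet and have diameter at most \<open>2/3^n\<close>; the sum of the diameters to the power
  \<open>carpet_dim\<close> does not depend on \<open>n\<close>.
\<close>

lemma carpet_outer_finite: "carpet_outer carpet < top"
proof -
  have "hausdorff_pre carpet_dim \<delta> carpet \<le> ennreal (2 powr carpet_dim)" if "\<delta> > 0" for \<delta>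
  proof -
    have "(\<lambda>n. 2 * (1/3) ^ n :: real) \<longlonglongrightarrow> 2 * 0" by (intro tendsto_mult_left LIMSEQ_power_zero) auto
    then have "\<forall>\<^sub>F n in sequentially. 2 * (1/3) ^ n < \<delta>" by (rule order_tendstoD(2)) (use that in simp)
    then obtain n :: nat where n: "2 * (1/3) ^ n < \<delta>" by (auto simp: eventually_sequentially)
    obtain h where h: "bij_betw h {0..<card (words n)} (words n)"
      using ex_bij_betw_nat_finite[OF finite_words] by blast
    define U where "U i = (if i < 8 ^ n then cell (h i) else {})" for i
    have hw: "h i \<in> words n" if "i < 8 ^ n" for i
      using h that by (auto simp: bij_betw_def card_words)
    have diam: "diameter (U i) \<le> 2 / 3 ^ n" for i
      using hw[of i] by (auto simp: U_def length_words dist_norm[symmetric] intro!: diameter_le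
          dest: cell_dist)
    have bdd: "bounded (U i)" for i
      by (auto simp: U_def compact_imp_bounded compact_cell)
    have "carpet \<subseteq> (\<Union>i. U i)"
    proof
      fix x assume "x \<in> carpet"
      then obtain w where "w \<in> words n" "x \<in> cell w" using carpet_cells[of n] by blast
      moreover from this obtain i where "i < 8 ^ n" "w = h i"
        using h unfolding bij_betw_def card_words by (metis atLeastLessThan_iff imageE)
      ultimately show "x \<in> (\<Union>i. U i)" by (auto simp: U_def intro!: exI[of _ i])
    qed
    then have "hausdorff_pre carpet_dim \<delta> carpet \<le> (\<Sum>i. ennreal (diameter (U i) powr carpet_dim))"
    proof (rule hausdorff_pre_le)
      show "diameter (U i) \<le> \<delta>" for i
        using diam[of i] n by (simp add: power_divide)
    qed (rule bdd)
    also have "\<dots> = (\<Sum>i<8 ^ n. ennreal (diameter (U i) powr carpet_dim))"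
      using carpet_dim_pos by (intro suminf_finite) (auto simp: U_def)
    also have "\<dots> \<le> (\<Sum>i<8 ^ n::nat. ennreal (2 powr carpet_dim / 8 ^ n))"
    proof (intro sum_mono ennreal_leI)
      fix i
      have "diameter (U i) powr carpet_dim \<le> (2 * (1 / 3 ^ n)) powr carpet_dim"
        using diam[of i] bdd[of i] carpet_dim_pos by (intro powr_mono2) (auto intro: diameter_ge_0)
      also have "\<dots> = 2 powr carpet_dim / 8 ^ n"
        by (subst powr_mult) (auto simp: inverse_power3_powr_carpet_dim)
      finally show "diameter (U i) powr carpet_dim \<le> 2 powr carpet_dim / 8 ^ n" .
    qed
    also have "\<dots> = ennreal (2 powr carpet_dim)"
      by (simp add: ennreal_of_nat_eq_real_of_nat ennreal_mult'[symmetric])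
    finally show ?thesis .
  qed
  then have "carpet_outer carpet \<le> ennreal (2 powr carpet_dim)"
    unfolding hausdorff_outer_def by (intro SUP_least) auto
  then show ?thesis by (rule le_less_trans) simp
qed

text \<open>
  \<open>1/3^m\<close> is the power of \<open>1/3\<close> just above \<open>d\<close>. The error term \<open>\<eta>\<close> covers \<open>d = 0\<close>: the points of a covering contribute
  nothing to its sum, but they have to be thickened to open sets.
\<close>

lemma diameter_scale:
  assumes "0 \<le> d" "d < 1" "0 < \<eta>"
  obtains m :: nat where "d < 1 / 3 ^ m" "1 / 8 ^ m \<le> 8 * d powr carpet_dim + \<eta>"
proof (cases "d = 0")
  case True
  have "\<forall>\<^sub>F m in sequentially. (1/8::real) ^ m < \<eta>"
    using LIMSEQ_power_zero[of "1/8::real"] \<open>0 < \<eta>\<close> by (auto dest: order_tendstoD)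
  then obtain m :: nat where "(1/8::real) ^ m < \<eta>" by (auto simp: eventually_sequentially)
  then show thesis using that[of m] True by (simp add: power_divide)
next
  case False
  have "\<forall>\<^sub>F m in sequentially. (1/3::real) ^ m < d"
    using False assms by (intro order_tendstoD(2)[OF LIMSEQ_power_zero]) auto
  then have ex: "\<exists>m::nat. (1/3::real) ^ m < d" by (auto simp: eventually_sequentially)
  define k where "k = (LEAST m. (1/3::real) ^ m \<le> d)"
  have k: "(1/3) ^ k \<le> d" unfolding k_def by (rule LeastI_ex) (use ex in \<open>auto intro: less_imp_le\<close>)
  with \<open>d < 1\<close> obtain m where m: "k = Suc m" by (cases k) auto
  have "\<not> (1/3) ^ m \<le> d"
    using not_less_Least[of m "\<lambda>m. (1/3::real) ^ m \<le> d"] m by (simp add: k_def)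
  moreover have "1 / 8 ^ m \<le> 8 * d powr carpet_dim"
  proof -
    have "1 / 8 ^ Suc m = (1 / 3 ^ Suc m) powr carpet_dim" by (rule inverse_power3_powr_carpet_dim[symmetric])
    also have "\<dots> \<le> d powr carpet_dim"
      using k m carpet_dim_pos by (intro powr_mono2) (auto simp: power_divide)
    finally show ?thesis by simp
  qed
  ultimately show thesis using that[of m] \<open>0 < \<eta>\<close> by (simp add: power_divide)
qed

text \<open>
  A mass distribution argument in which cells are counted instead of measured. Each member of the covering is thickened to an open
  set \<open>V i\<close> at a scale \<open>1/3^m\<close> comparable to its diameter; this set meets at most 25 cells of level \<open>m\<close>, thus at most
  \<open>25 * 8^(M-m)\<close> cells of a deeper level \<open>M\<close> have their first vertex in it. By compactness finitely many of the \<open>V i\<close>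
  contain the first vertices of all \<open>8^M\<close> cells of a common level, so \<open>1 \<le> 25 * (\<Sum>i. 1/8^(m i))\<close>.
\<close>

lemma carpet_pre_lower: "ennreal (1 / 400) \<le> hausdorff_pre carpet_dim (1/2) carpet"
  unfolding hausdorff_pre_def
proof (rule INF_greatest, clarify)
  fix U :: "nat \<Rightarrow> (real^2) set"
  assume cov: "carpet \<subseteq> (\<Union>i. U i)" and U: "\<forall>i. bounded (U i) \<and> diameter (U i) \<le> 1/2"
  have "\<exists>m. diameter (U i) < 1 / 3 ^ m \<and>
      1 / 8 ^ m \<le> 8 * diameter (U i) powr carpet_dim + (1/50) * (1/2) ^ Suc i" for i
  proof -
    have "diameter (U i) \<le> 1/2" using U by blast
    then have "diameter (U i) < 1" by simp
    then show ?thesis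
      using diameter_scale[of "diameter (U i)" "(1/50) * (1/2) ^ Suc i"] U diameter_ge_0
      by (metis zero_less_divide_1_iff zero_less_mult_iff zero_less_numeral zero_less_power)
  qed
  then obtain m where m: "\<And>i. diameter (U i) < 1 / 3 ^ m i"
      "\<And>i. 1 / 8 ^ m i \<le> 8 * diameter (U i) powr carpet_dim + (1/50) * (1/2) ^ Suc i"
    by metis
  define V where "V i = (\<Union>y\<in>U i. ball y (1 / 3 ^ m i))" for i
  have "carpet \<subseteq> (\<Union>i. V i)"
  proof
    fix x assume "x \<in> carpet"
    then obtain i where "x \<in> U i" using cov by blast
    then have "x \<in> V i" by (auto simp: V_def intro!: bexI[of _ x])
    then show "x \<in> (\<Union>i. V i)" by blast
  qed
  moreover have "open (V i)" for i by (auto simp: V_def)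
  ultimately obtain I where I: "finite I" "carpet \<subseteq> (\<Union>i\<in>I. V i)"
    using compactE_image[OF carpet_props(1), of UNIV V] by metis
  \<comment> \<open>A level deep enough to count cells for all members of the subcover at once.\<close>
  define M where "M = Max (insert 0 (m ` I))"
  have mM: "m i \<le> M" if "i \<in> I" for i using that I by (auto simp: M_def)
  define T where "T i = {w\<in>words (m i). \<exists>y\<in>cell w. y \<in> V i}" for i
  have finT: "finite (T i)" for i by (simp add: T_def finite_words)
  have cardT: "card (T i) \<le> 25" for i
  proof (cases "U i = {}")
    case False
    then obtain u where u: "u \<in> U i" by auto
    have "T i \<subseteq> {w\<in>words (m i). \<exists>y\<in>cell w. dist u y < 2 / 3 ^ m i}"
    proof
      fix w assume "w \<in> T i"
      then obtain y z where "w \<in> words (m i)" "y \<in> cell w" "z \<in> U i" "dist z y < 1 / 3 ^ m i"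
        by (auto simp: T_def V_def)
      moreover from this have "dist u z < 1 / 3 ^ m i"
        using diameter_bounded_bound[of "U i" u z] U u \<open>z \<in> U i\<close> m(1)[of i] by auto
      ultimately have "dist u z + dist z y < 1 / 3 ^ m i + 1 / 3 ^ m i"
        by (intro add_strict_mono)
      then have "dist u y < 2 / 3 ^ m i" using dist_triangle[of u y z] by simp
      then show "w \<in> {w\<in>words (m i). \<exists>y\<in>cell w. dist u y < 2 / 3 ^ m i}"
        using \<open>y \<in> cell w\<close> \<open>w \<in> words (m i)\<close> by blast
    qed
    then have "card (T i) \<le> card {w\<in>words (m i). \<exists>y\<in>cell w. dist u y < 2 / 3 ^ m i}"
      by (intro card_mono) (auto simp: finite_words)
    then show ?thesis using card_cells_near_point le_trans by blast
  qed (simp add: T_def V_def)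
  have sub: "words M \<subseteq> (\<Union>i\<in>I. (\<lambda>(a,b). a @ b) ` (T i \<times> words (M - m i)))"
  proof
    fix w assume w: "w \<in> words M"
    define x where "x = word_map w (carpet_pt 0)"
    have xw: "x \<in> cell w" by (simp add: x_def vertex_in_cell)
    then have "x \<in> carpet" using cell_subset_carpet w by blast
    then obtain i where i: "i \<in> I" "x \<in> V i" using I by blast
    have tk: "take (m i) w \<in> words (m i)" "drop (m i) w \<in> words (M - m i)"
      using w mM[OF i(1)] by (auto simp: words_def dest: in_set_takeD in_set_dropD)
    have "x \<in> cell (take (m i) w)"
      using xw cell_append_subset[OF tk(2), of "take (m i) w"] by auto
    then have "take (m i) w \<in> T i" using i tk by (auto simp: T_def)
    then show "w \<in> (\<Union>i\<in>I. (\<lambda>(a,b). a @ b) ` (T i \<times> words (M - m i)))"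
      using i tk by (intro UN_I[of i] image_eqI[of _ _ "(take (m i) w, drop (m i) w)"]) auto
  qed
  have "8 ^ M = card (words M)" by (simp add: card_words)
  also have "\<dots> \<le> card (\<Union>i\<in>I. (\<lambda>(a,b). a @ b) ` (T i \<times> words (M - m i)))"
    using I finT finite_words by (intro card_mono sub) auto
  also have "\<dots> \<le> (\<Sum>i\<in>I. card ((\<lambda>(a,b). a @ b) ` (T i \<times> words (M - m i))))"
    by (rule card_UN_le[OF I(1)])
  also have "\<dots> \<le> (\<Sum>i\<in>I. 25 * 8 ^ (M - m i))"
  proof (rule sum_mono)
    fix i
    have "card ((\<lambda>(a,b). a @ b) ` (T i \<times> words (M - m i))) \<le> card (T i \<times> words (M - m i))"
      by (rule card_image_le) (simp add: finT finite_words)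
    also have "\<dots> \<le> 25 * 8 ^ (M - m i)"
      using cardT[of i] by (simp add: card_cartesian_product card_words)
    finally show "card ((\<lambda>(a,b). a @ b) ` (T i \<times> words (M - m i))) \<le> 25 * 8 ^ (M - m i)" .
  qed
  finally have "real (8 ^ M) \<le> real (\<Sum>i\<in>I. 25 * 8 ^ (M - m i))" by (rule of_nat_mono)
  also have "\<dots> = (\<Sum>i\<in>I. 25 * (8 ^ M / 8 ^ m i))"
    unfolding of_nat_sum of_nat_mult of_nat_power
    by (intro sum.cong refl) (use mM in \<open>simp add: power_diff\<close>)
  also have "\<dots> = 8 ^ M * (25 * (\<Sum>i\<in>I. 1 / 8 ^ m i))"
    by (simp add: sum_distrib_left field_simps)
  finally have "1 \<le> 25 * (\<Sum>i\<in>I. 1 / 8 ^ m i :: real)" by simp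
  also have "\<dots> \<le> 25 * (\<Sum>i\<in>I. 8 * diameter (U i) powr carpet_dim + (1/50) * (1/2) ^ Suc i)"
    by (intro mult_left_mono sum_mono m) auto
  also have "\<dots> = 200 * (\<Sum>i\<in>I. diameter (U i) powr carpet_dim) + 1/2 * (\<Sum>i\<in>I. (1/2) ^ Suc i)"
    by (simp add: sum.distrib sum_distrib_left sum_distrib_right algebra_simps)
  finally have "1 \<le> 200 * (\<Sum>i\<in>I. diameter (U i) powr carpet_dim) + 1/2 * (\<Sum>i\<in>I. (1/2) ^ Suc i)" .
  moreover have "(\<Sum>i\<in>I. (1/2::real) ^ Suc i) \<le> 1"
    using sum_le_suminf[OF sums_summable[OF power_half_series] I(1)] sums_unique[OF power_half_series] by simp
  ultimately have "1 / 400 \<le> (\<Sum>i\<in>I. diameter (U i) powr carpet_dim)" by linarith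
  then have "ennreal (1 / 400) \<le> ennreal (\<Sum>i\<in>I. diameter (U i) powr carpet_dim)" by (rule ennreal_leI)
  also have "\<dots> = (\<Sum>i\<in>I. ennreal (diameter (U i) powr carpet_dim))" by simp
  also have "\<dots> \<le> (\<Sum>i. ennreal (diameter (U i) powr carpet_dim))"
    by (rule sum_le_suminf) (use I in auto)
  finally show "ennreal (1 / 400) \<le> (\<Sum>i. ennreal (diameter (U i) powr carpet_dim))" .
qed

lemma carpet_outer_pos: "carpet_outer carpet > 0"
proof -
  have "0 < ennreal (1 / 400)" by simp
  also have "\<dots> \<le> carpet_outer carpet"
    using carpet_pre_lower hausdorff_pre_le_outer[of "1/2" carpet_dim carpet] by (auto intro: order_trans)
  finally show ?thesis .
qed

lemma sets_carpet_measure [simp, measurable_cong]: "sets carpet_measure = sets borel"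
  by (simp add: carpet_measure_def)

lemma space_carpet_measure [simp]: "space carpet_measure = UNIV"
  by (simp add: carpet_measure_def)

lemma cell_borel [measurable, simp]: "cell w \<in> sets borel"
  by (simp add: compact_imp_closed compact_cell)

lemma carpet_borel [measurable, simp]: "carpet \<in> sets borel"
  using cell_borel[of "[]"] by simp

lemma emeasure_carpet_measure:
  assumes "A \<in> sets borel"
  shows "emeasure carpet_measure A = carpet_outer (carpet \<inter> A) / carpet_outer carpet"
  using assms
  by (simp add: carpet_measure_def emeasure_uniform_measure emeasure_hausdorff_measure)

text \<open>
  The normalising constant cancels because the Hausdorff measure of the carpet is neither zero nor infinite.
\<close>

lemma emeasure_cell:
  assumes "w \<in> words n"
  shows "emeasure carpet_measure (cell w) = ennreal (1 / 8 ^ n)"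
proof -
  have "carpet \<inter> cell w = cell w" using cell_subset_carpet[OF assms] by auto
  then have "emeasure carpet_measure (cell w) =
      ennreal (1 / 8 ^ n) * (carpet_outer carpet / carpet_outer carpet)"
    using assms by (simp add: emeasure_carpet_measure carpet_outer_cell ennreal_times_divide)
  also have "carpet_outer carpet / carpet_outer carpet = 1"
    using carpet_outer_pos carpet_outer_finite by (intro ennreal_divide_self) auto
  finally show ?thesis by simp
qed

lemma finite_measure_carpet: "finite_measure carpet_measure"
proof (rule finite_measureI)
  have "emeasure carpet_measure UNIV = carpet_outer carpet / carpet_outer carpet"
    by (simp add: emeasure_carpet_measure)
  also have "\<dots> = 1"
    using carpet_outer_pos carpet_outer_finite by (intro ennreal_divide_self) auto
  finally show "emeasure carpet_measure (space carpet_measure) \<noteq> \<infinity>" by simp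
qed

section \<open>Weighted series with a telescoping bound\<close>

lemma suminf_swap_ennreal:
  fixes f :: "nat \<Rightarrow> nat \<Rightarrow> ennreal"
  shows "(\<Sum>n. \<Sum>j. f n j) = (\<Sum>j. \<Sum>n. f n j)"
proof -
  have "(\<Sum>n. \<Sum>j. f n j) = (\<integral>\<^sup>+n. (\<Sum>j. f n j) \<partial>count_space UNIV)"
    by (rule nn_integral_count_space_nat[symmetric])
  also have "\<dots> = (\<Sum>j. \<integral>\<^sup>+n. f n j \<partial>count_space UNIV)"
    by (rule nn_integral_suminf) simp
  finally show ?thesis by (simp add: nn_integral_count_space_nat)
qed

lemma suminf_shift_le_ennreal:
  fixes f :: "nat \<Rightarrow> ennreal"
  shows "(\<Sum>n. f (n + j)) \<le> suminf f"
  using suminf_offset[of f j] by simp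

text \<open>
  A discrete Hardy inequality: collecting the terms with \<open>n + j = m\<close> leaves the geometric series of ratio \<open>q / r < 1\<close>.
\<close>

lemma weighted_tail_sum:
  fixes r q :: real and d :: "nat \<Rightarrow> ennreal"
  assumes "0 \<le> q" "q < r"
  shows "(\<Sum>n. ennreal (r ^ n) * (\<Sum>j. ennreal (q ^ j) * d (n + j)))
         \<le> ennreal (r / (r - q)) * (\<Sum>m. ennreal (r ^ m) * d m)"
proof -
  have "r > 0" using assms by simp
  have "(\<Sum>n. ennreal (r ^ n) * (\<Sum>j. ennreal (q ^ j) * d (n + j)))
      = (\<Sum>n. \<Sum>j. ennreal ((q / r) ^ j) * (ennreal (r ^ (n + j)) * d (n + j)))"
  proof -
    have "ennreal (r ^ n) * (ennreal (q ^ j) * d (n + j)) =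
          ennreal ((q / r) ^ j) * (ennreal (r ^ (n + j)) * d (n + j))" for n j
      using assms \<open>r > 0\<close>
      by (simp add: mult.assoc[symmetric] ennreal_mult''[symmetric] power_add power_divide
          mult.commute[of "q ^ j"])
    then show ?thesis by (simp flip: ennreal_suminf_cmult)
  qed
  also have "\<dots> = (\<Sum>j. \<Sum>n. ennreal ((q / r) ^ j) * (ennreal (r ^ (n + j)) * d (n + j)))"
    by (rule suminf_swap_ennreal)
  also have "\<dots> \<le> (\<Sum>j. ennreal ((q / r) ^ j) * (\<Sum>m. ennreal (r ^ m) * d m))"
    unfolding ennreal_suminf_cmult
    by (intro suminf_le mult_left_mono allI suminf_shift_le_ennreal[of "\<lambda>m. ennreal (r ^ m) * d m"]) auto
  also have "\<dots> = (\<Sum>j. ennreal ((q / r) ^ j)) * (\<Sum>m. ennreal (r ^ m) * d m)" by simp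
  also have "(\<Sum>j. ennreal ((q / r) ^ j)) = ennreal (r / (r - q))"
  proof -
    have "(\<lambda>j. (q / r) ^ j) sums (1 / (1 - q / r))"
      using assms \<open>r > 0\<close> by (intro geometric_sums) auto
    moreover have "1 / (1 - q / r) = r / (r - q)" using assms \<open>r > 0\<close> by (simp add: field_simps)
    ultimately show ?thesis using assms \<open>r > 0\<close> by (intro suminf_ennreal_eq) auto
  qed
  finally show ?thesis .
qed

text \<open>
  The common skeleton of both halves of the theorem. \<open>H l n\<close> is the quadratic deviation between level \<open>n\<close> and level \<open>n + l\<close>,
  which is compared with the deviation between the levels \<open>n + 1\<close> and \<open>n + 1 + l\<close> at the cost of one step \<open>d n\<close>. If a factor
  \<open>q\<close> less than the ratio \<open>r\<close> of the weights is lost per step, then the deviation \<open>X n\<close> between level \<open>n\<close> and the limit is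
  summable with the same weights as the one-step deviations.
\<close>

lemma telescoping_series:
  fixes r q :: real and H e :: "nat \<Rightarrow> nat \<Rightarrow> ennreal" and d X :: "nat \<Rightarrow> ennreal"
  assumes q: "0 \<le> q" "q < r" and c: "0 \<le> c"
    and H0: "\<And>n. H 0 n = 0"
    and step: "\<And>l n. H (Suc l) n \<le> ennreal q * H l (Suc n) + d n"
    and X: "\<And>l n. X n \<le> ennreal c * H l n + e l n"
    and e: "\<And>n. (\<lambda>l. e l n) \<longlonglongrightarrow> 0"
  shows "(\<Sum>n. ennreal (r ^ n) * X n) \<le> ennreal (c * (r / (r - q))) * (\<Sum>m. ennreal (r ^ m) * d m)"
proof -
  define S where "S n = (\<Sum>j. ennreal (q ^ j) * d (n + j))" for n
  have "H l n \<le> (\<Sum>j<l. ennreal (q ^ j) * d (n + j))" for l n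
  proof (induction l arbitrary: n)
    case (Suc l)
    have "H (Suc l) n \<le> ennreal q * (\<Sum>j<l. ennreal (q ^ j) * d (Suc n + j)) + d n"
      by (rule order_trans[OF step]) (intro add_right_mono mult_left_mono Suc.IH, simp)
    also have "\<dots> = (\<Sum>j<Suc l. ennreal (q ^ j) * d (n + j))"
      by (subst sum.lessThan_Suc_shift)
         (simp add: sum_distrib_left mult.assoc[symmetric] ennreal_mult q add.commute)
    finally show ?case .
  qed (simp add: H0)
  then have HS: "H l n \<le> S n" for l n
    unfolding S_def by (rule order_trans) (intro sum_le_suminf, auto)
  have XS: "X n \<le> ennreal c * S n" for n
  proof (rule LIMSEQ_le_const)
    show "(\<lambda>l. ennreal c * S n + e l n) \<longlonglongrightarrow> ennreal c * S n"
      using tendsto_add[OF tendsto_const e, of "ennreal c * S n" n] by simp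
    show "\<exists>N. \<forall>l\<ge>N. X n \<le> ennreal c * S n + e l n"
      using X HS by (meson order_trans add_right_mono mult_left_mono zero_le)
  qed
  have "(\<Sum>n. ennreal (r ^ n) * X n) \<le> (\<Sum>n. ennreal c * (ennreal (r ^ n) * S n))"
    by (subst mult.left_commute) (intro suminf_le allI mult_left_mono XS, auto)
  also have "\<dots> = ennreal c * (\<Sum>n. ennreal (r ^ n) * S n)" by simp
  also have "\<dots> \<le> ennreal c * (ennreal (r / (r - q)) * (\<Sum>m. ennreal (r ^ m) * d m))"
    unfolding S_def by (intro mult_left_mono weighted_tail_sum q) auto
  finally show ?thesis
    by (subst ennreal_mult) (use q c in \<open>simp_all add: mult.assoc\<close>)
qed

text \<open>
  The sum of \<open>3 powr s\<close> to the power \<open>m\<close> over all scales with \<open>3^m \<le> t\<close> is dominated by its last term. For \<open>t\<close> inverse to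
  \<open>norm (x - y)\<close> this is how the singular kernel of the integral energy arises.
\<close>

lemma truncated_geometric_sum:
  fixes s t :: real
  assumes "s > 0" "t > 0"
  shows "(\<Sum>m. ennreal ((3 powr s) ^ m) * of_bool (3 ^ m \<le> t)) \<le> ennreal (3 powr s / (3 powr s - 1) * t powr s)"
proof -
  define a where "a = 3 powr s"
  have "a > 1" using \<open>s > 0\<close> by (simp add: a_def)
  define S where "S = {m::nat. 3 ^ m \<le> t}"
  have "\<forall>\<^sub>F m in sequentially. t < (3::real) ^ m"
    using filterlim_realpow_sequentially_gt1[of "3::real"]
    by (auto simp: filterlim_at_infinity_imp_norm_at_top filterlim_at_top_dense
        dest!: filterlim_at_infinity_imp_norm_at_top)
  then obtain M where "\<And>m. m \<ge> M \<Longrightarrow> t < (3::real) ^ m" by (auto simp: eventually_sequentially)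
  then have "S \<subseteq> {..<M}" by (auto simp: S_def) (meson leD leI)
  then have fin: "finite S" using finite_subset by blast
  \<comment> \<open>Only finitely many terms are nonzero, as the powers of 3 exceed \<open>t\<close> eventually.\<close>
  have eq: "(\<Sum>m. ennreal (a ^ m) * of_bool (3 ^ m \<le> t)) = (\<Sum>m\<in>S. ennreal (a ^ m))"
    using fin by (subst suminf_finite[of S]) (auto simp: S_def intro!: sum.cong)
  show ?thesis
  proof (cases "S = {}")
    case True
    then show ?thesis using eq unfolding a_def by simp
  next
    case False
    define N where "N = Max S"
    have N: "3 ^ N \<le> t" using Max_in[OF fin False] by (simp add: N_def S_def)
    have "a ^ N = (3 ^ N) powr s"
      by (simp add: a_def powr_realpow[symmetric] powr_powr mult.commute)
    also have "\<dots> \<le> t powr s" using N \<open>s > 0\<close> by (intro powr_mono2) auto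
    finally have aN: "a ^ N \<le> t powr s" .
    have "(\<Sum>m\<in>S. a ^ m) \<le> (\<Sum>m<Suc N. a ^ m)"
      using fin \<open>a > 1\<close> by (intro sum_mono2) (auto simp: N_def less_Suc_eq_le)
    also have "\<dots> = (a ^ Suc N - 1) / (a - 1)" using \<open>a > 1\<close> by (intro geometric_sum) auto
    also have "\<dots> \<le> a ^ Suc N / (a - 1)" using \<open>a > 1\<close> by (intro divide_right_mono) auto
    also have "\<dots> = a / (a - 1) * a ^ N" by simp
    also have "\<dots> \<le> a / (a - 1) * t powr s" using aN \<open>a > 1\<close> by (intro mult_left_mono) auto
    finally have "(\<Sum>m\<in>S. a ^ m) \<le> a / (a - 1) * t powr s" .
    then have "(\<Sum>m\<in>S. ennreal (a ^ m)) \<le> ennreal (a / (a - 1) * t powr s)"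
      using \<open>a > 1\<close> by (simp add: ennreal_leI)
    then show ?thesis using eq by (simp add: a_def)
  qed
qed

section \<open>Cell averages\<close>

interpretation carpet: finite_measure carpet_measure
  by (rule finite_measure_carpet)

text \<open>
  The parameter \<open>e\<close> lets the loss per telescoping step come as close to 1 as needed; a fixed factor 2 would only serve exponents
  \<open>\<beta>\<close> that exceed \<open>carpet_dim\<close> by more than \<open>log 3 2\<close>.
\<close>

lemma square_add_le:
  fixes x y e :: real
  assumes "e > 0"
  shows "(x + y)\<^sup>2 \<le> (1 + e) * x\<^sup>2 + (1 + 1 / e) * y\<^sup>2"
proof -
  have "0 \<le> (e * x - y)\<^sup>2 / e" using assms by simp
  also have "\<dots> = e * x\<^sup>2 - 2 * x * y + y\<^sup>2 / e"
    using assms by (simp add: power2_eq_square field_simps)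
  finally show ?thesis using assms by (simp add: power2_eq_square algebra_simps)
qed

lemma square_add_le2: "((x::real) + y)\<^sup>2 \<le> 2 * x\<^sup>2 + 2 * y\<^sup>2"
  using square_add_le[of 1 x y] by simp

definition cell_energy :: "(real^2 \<Rightarrow> real) \<Rightarrow> nat list \<Rightarrow> nat list \<Rightarrow> ennreal" where
  "cell_energy u w v =
     (\<integral>\<^sup>+x. \<integral>\<^sup>+y. ennreal ((u x - u y)\<^sup>2) * (indicator (cell w) x * indicator (cell v) y)
        \<partial>carpet_measure \<partial>carpet_measure)"

text \<open>
  The factor is the inverse of the measure of the cell for words with letters below 8.
\<close>

definition cell_average :: "(real^2 \<Rightarrow> real) \<Rightarrow> nat list \<Rightarrow> real" where
  "cell_average u w = 8 ^ length w * (\<integral>x. indicator (cell w) x * u x \<partial>carpet_measure)"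

lemma besov_energy_alt:
  "besov_energy \<beta> u =
     (\<integral>\<^sup>+x. \<integral>\<^sup>+y. ennreal ((u x - u y)\<^sup>2 / norm (x - y) powr (carpet_dim + \<beta>)) *
        (indicator carpet x * indicator carpet y) \<partial>carpet_measure \<partial>carpet_measure)"
  unfolding besov_energy_def
  by (intro nn_integral_cong) (auto split: split_indicator)

lemma carpet_oscillation:
  assumes cont: "continuous_on carpet u" and "e > 0"
  obtains N where "\<And>n w x y. n \<ge> N \<Longrightarrow> w \<in> words n \<Longrightarrow> x \<in> cell w \<Longrightarrow> y \<in> cell w \<Longrightarrow> \<bar>u x - u y\<bar> \<le> (e::real)"
proof -
  have "uniformly_continuous_on carpet u"
    by (rule compact_uniformly_continuous[OF cont carpet_props(1)])
  then obtain d where d: "d > 0" "\<And>x y. x \<in> carpet \<Longrightarrow> y \<in> carpet \<Longrightarrow> dist x y < d \<Longrightarrow> dist (u x) (u y) < e"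
    unfolding uniformly_continuous_on_def using \<open>e > 0\<close> by (metis dist_commute)
  have "(\<lambda>n. 2 * (1/3) ^ n :: real) \<longlonglongrightarrow> 2 * 0" by (intro tendsto_mult_left LIMSEQ_power_zero) auto
  then have "\<forall>\<^sub>F n in sequentially. 2 * (1/3) ^ n < d" by (rule order_tendstoD(2)) (use d in simp)
  then obtain N :: nat where N: "\<And>n. n \<ge> N \<Longrightarrow> 2 * (1/3) ^ n < d" by (auto simp: eventually_sequentially)
  show thesis
  proof
    fix n w x y assume n: "n \<ge> N" and w: "w \<in> words n" "x \<in> cell w" "y \<in> cell w"
    have "dist x y \<le> 2 / 3 ^ n" using cell_dist[OF w(2,3)] w by (simp add: length_words)
    also have "\<dots> < d" using N[OF n] by (simp add: power_divide)
    finally have "dist (u x) (u y) < e"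
      using d(2) cell_subset_carpet[OF w(1)] w by blast
    then show "\<bar>u x - u y\<bar> \<le> e" by (simp add: dist_real_def)
  qed
qed

text \<open>
  Jensen's inequality for the square, obtained by integrating over the cell the tangent bound
  \<open>(u x - c)^2 \<ge> (a - c)^2 + 2 * (a - c) * (u x - a)\<close> with \<open>a\<close> the average.
\<close>

lemma cell_average_variance:
  fixes u :: "real^2 \<Rightarrow> real"
  assumes cont: "continuous_on carpet u" and [measurable]: "u \<in> borel_measurable borel" and w: "w \<in> words n"
  shows "ennreal ((cell_average u w - c)\<^sup>2) \<le>
    ennreal (8 ^ n) * (\<integral>\<^sup>+x. ennreal ((u x - c)\<^sup>2) * indicator (cell w) x \<partial>carpet_measure)"
proof -
  let ?I = "\<lambda>x. indicator (cell w) x :: real"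
  have "bounded (u ` carpet)"
    by (intro compact_imp_bounded compact_continuous_image cont carpet_props)
  then obtain B where B: "\<And>x. x \<in> carpet \<Longrightarrow> \<bar>u x\<bar> \<le> B"
    unfolding bounded_iff by auto
  have "0 \<le> B" using B carpet_props(2) by fastforce
  have Bw: "x \<in> cell w \<Longrightarrow> \<bar>u x\<bar> \<le> B" for x using B cell_subset_carpet[OF w] by blast
  have int1: "integrable carpet_measure (\<lambda>x. ?I x * u x)"
    by (rule carpet.integrable_const_bound[of _ B])
       (auto simp: Bw \<open>0 \<le> B\<close> split: split_indicator)
  have int2: "integrable carpet_measure (\<lambda>x. ?I x * (u x - c)\<^sup>2)"
  proof (rule carpet.integrable_const_bound[of _ "(B + \<bar>c\<bar>)\<^sup>2"])
    have "(u x - c)\<^sup>2 \<le> (B + \<bar>c\<bar>)\<^sup>2" if "x \<in> cell w" for x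
      using Bw[OF that] \<open>0 \<le> B\<close> by (intro abs_le_square_iff[THEN iffD1]) auto
    then show "AE x in carpet_measure. norm (?I x * (u x - c)\<^sup>2) \<le> (B + \<bar>c\<bar>)\<^sup>2"
      by (auto split: split_indicator)
  qed measurable
  have int0: "integrable carpet_measure ?I"
    by (rule carpet.integrable_const_bound[of _ 1]) (auto split: split_indicator)
  define a where "a = cell_average u w"
  define m where "m = measure carpet_measure (cell w)"
  have m: "m = 1 / 8 ^ n" by (simp add: m_def measure_def emeasure_cell[OF w])
  have Iu: "(\<integral>x. ?I x * u x \<partial>carpet_measure) = a * m"
    using w by (simp add: a_def cell_average_def m length_words)
  have II: "(\<integral>x. ?I x \<partial>carpet_measure) = m" by (simp add: m_def)
  have "(a - c)\<^sup>2 * m = ((a - c)\<^sup>2 - 2 * (a - c) * a) * (\<integral>x. ?I x \<partial>carpet_measure) +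
        2 * (a - c) * (\<integral>x. ?I x * u x \<partial>carpet_measure)"
    unfolding Iu II by (simp add: algebra_simps)
  also have "\<dots> = (\<integral>x. ((a - c)\<^sup>2 - 2 * (a - c) * a) * ?I x + 2 * (a - c) * (?I x * u x) \<partial>carpet_measure)"
    using int0 int1 by simp
  also have "\<dots> \<le> (\<integral>x. ?I x * (u x - c)\<^sup>2 \<partial>carpet_measure)"
  proof (intro integral_mono)
    fix x
    have "(u x - c)\<^sup>2 - ((a - c)\<^sup>2 - 2 * (a - c) * a + 2 * (a - c) * u x) = (u x - a)\<^sup>2"
      by (simp add: power2_eq_square algebra_simps)
    then have "(a - c)\<^sup>2 - 2 * (a - c) * a + 2 * (a - c) * u x \<le> (u x - c)\<^sup>2"
      by (metis diff_ge_0_iff_ge zero_le_power2)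
    then show "((a - c)\<^sup>2 - 2 * (a - c) * a) * ?I x + 2 * (a - c) * (?I x * u x) \<le> ?I x * (u x - c)\<^sup>2"
      by (auto split: split_indicator)
  qed (use int0 int1 int2 in auto)
  finally have "(a - c)\<^sup>2 * m * 8 ^ n \<le> (\<integral>x. ?I x * (u x - c)\<^sup>2 \<partial>carpet_measure) * 8 ^ n"
    by (rule mult_right_mono) simp
  then have "(a - c)\<^sup>2 \<le> 8 ^ n * (\<integral>x. ?I x * (u x - c)\<^sup>2 \<partial>carpet_measure)"
    by (simp add: m mult.commute)
  then have "ennreal ((a - c)\<^sup>2) \<le> ennreal (8 ^ n) * ennreal (\<integral>x. ?I x * (u x - c)\<^sup>2 \<partial>carpet_measure)"
    by (simp add: ennreal_mult'[symmetric] ennreal_leI)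
  also have "ennreal (\<integral>x. ?I x * (u x - c)\<^sup>2 \<partial>carpet_measure) = (\<integral>\<^sup>+x. ennreal (?I x * (u x - c)\<^sup>2) \<partial>carpet_measure)"
    by (rule nn_integral_eq_integral[symmetric, OF int2]) auto
  also have "\<dots> = (\<integral>\<^sup>+x. ennreal ((u x - c)\<^sup>2) * indicator (cell w) x \<partial>carpet_measure)"
    by (intro nn_integral_cong) (auto split: split_indicator)
  finally show ?thesis by (simp add: a_def)
qed

lemma cell_average_close:
  fixes u :: "real^2 \<Rightarrow> real"
  assumes cont: "continuous_on carpet u" and meas[measurable]: "u \<in> borel_measurable borel" and w: "w \<in> words n"
    and e: "0 \<le> e" "\<And>x. x \<in> cell w \<Longrightarrow> \<bar>u x - c\<bar> \<le> e"
  shows "(cell_average u w - c)\<^sup>2 \<le> e\<^sup>2"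
proof -
  have "ennreal ((cell_average u w - c)\<^sup>2) \<le>
    ennreal (8 ^ n) * (\<integral>\<^sup>+x. ennreal ((u x - c)\<^sup>2) * indicator (cell w) x \<partial>carpet_measure)"
    by (rule cell_average_variance) fact+
  also have "\<dots> \<le> ennreal (8 ^ n) * (\<integral>\<^sup>+x. ennreal (e\<^sup>2) * indicator (cell w) x \<partial>carpet_measure)"
    using e by (intro mult_left_mono nn_integral_mono)
      (auto split: split_indicator intro!: ennreal_leI simp: abs_le_square_iff[symmetric])
  also have "\<dots> = ennreal (8 ^ n) * (ennreal (e\<^sup>2) * ennreal (1 / 8 ^ n))"
    by (subst nn_integral_cmult_indicator) (auto simp: emeasure_cell[OF w])
  also have "\<dots> = ennreal (e\<^sup>2)" by (simp add: ennreal_mult'[symmetric])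
  finally show ?thesis by simp
qed

text \<open>
  The previous variance bound is used twice, first for the average over \<open>cell w\<close> and then, for fixed \<open>x\<close>, for the average over the
  subcell. The measures of the two cells contribute the factor \<open>8^n * 8^(n+1)\<close>.
\<close>

lemma cell_average_diff_le:
  fixes u :: "real^2 \<Rightarrow> real"
  assumes cont: "continuous_on carpet u" and meas[measurable]: "u \<in> borel_measurable borel"
    and w: "w \<in> words n" and "i < 8"
  shows "ennreal ((cell_average u w - cell_average u (w @ [i]))\<^sup>2) \<le> ennreal (8 * 64 ^ n) * cell_energy u w w"
proof -
  have wi: "w @ [i] \<in> words (Suc n)" using w \<open>i < 8\<close> by (rule snoc_in_words)
  have sub: "cell (w @ [i]) \<subseteq> cell w"
    by (rule cell_append_subset[of _ 1]) (use \<open>i < 8\<close> in \<open>auto simp: words_def\<close>)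
  have "ennreal ((cell_average u w - cell_average u (w @ [i]))\<^sup>2) \<le>
      ennreal (8 ^ n) * (\<integral>\<^sup>+x. ennreal ((u x - cell_average u (w @ [i]))\<^sup>2) * indicator (cell w) x \<partial>carpet_measure)"
    by (rule cell_average_variance[OF cont meas w])
  also have "\<dots> \<le> ennreal (8 ^ n) * (\<integral>\<^sup>+x. ennreal (8 ^ Suc n) *
     (\<integral>\<^sup>+y. ennreal ((u x - u y)\<^sup>2) * (indicator (cell w) x * indicator (cell w) y) \<partial>carpet_measure) \<partial>carpet_measure)"
  proof (intro mult_left_mono nn_integral_mono)
    fix x
    show "ennreal ((u x - cell_average u (w @ [i]))\<^sup>2) * indicator (cell w) x \<le> ennreal (8 ^ Suc n) *
       (\<integral>\<^sup>+y. ennreal ((u x - u y)\<^sup>2) * (indicator (cell w) x * indicator (cell w) y) \<partial>carpet_measure)"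
    proof (cases "x \<in> cell w")
      case True
      have "ennreal ((u x - cell_average u (w @ [i]))\<^sup>2) \<le>
          ennreal (8 ^ Suc n) * (\<integral>\<^sup>+y. ennreal ((u y - u x)\<^sup>2) * indicator (cell (w @ [i])) y \<partial>carpet_measure)"
        using cell_average_variance[OF cont meas wi, of "u x"] by (simp add: power2_commute)
      also have "\<dots> \<le> ennreal (8 ^ Suc n) * (\<integral>\<^sup>+y. ennreal ((u x - u y)\<^sup>2) * indicator (cell w) y \<partial>carpet_measure)"
        using sub by (intro mult_left_mono nn_integral_mono)
          (auto split: split_indicator simp: power2_commute)
      finally show ?thesis using True by simp
    qed simp
  qed auto
  also have "\<dots> = ennreal (8 ^ n) * (ennreal (8 ^ Suc n) * cell_energy u w w)"
    unfolding cell_energy_def by (subst nn_integral_cmult) measurable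
  also have "\<dots> = ennreal (8 * 64 ^ n) * cell_energy u w w"
  proof -
    have "(8::real) ^ n * 8 ^ Suc n = 8 * 64 ^ n"
      by (simp add: power_mult_distrib[symmetric])
    then show ?thesis by (simp only: mult.assoc[symmetric] ennreal_mult'[symmetric] zero_le_power zero_le_numeral)
  qed
  finally show ?thesis .
qed

text \<open>
  Comparing both end points of an edge with the average over the cell, and bounding the edges by all 64 pairs of vertices.
\<close>

lemma level_energy_le_cell_average:
  "level_energy \<beta> n u \<le> (3 powr (\<beta> - carpet_dim)) ^ n *
     (8 * (\<Sum>w\<in>words n. \<Sum>i<8. 2 * (u (word_map w (carpet_pt i)) - cell_average u w)\<^sup>2))"
proof -
  have r: "3 powr ((\<beta> - carpet_dim) * real n) = (3 powr (\<beta> - carpet_dim)) ^ n"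
    by (simp add: powr_realpow[symmetric] powr_powr)
  have "(\<Sum>(p, q) \<in> {(p, q). p \<in> cell_vertices w \<and> q \<in> cell_vertices w \<and> norm (p - q) = 1 / (2 * 3 ^ n)}.
             (u p - u q)\<^sup>2) / 2 \<le> 8 * (\<Sum>i<8. 2 * (u (word_map w (carpet_pt i)) - cell_average u w)\<^sup>2)" for w
  proof -
    define g where "g i = word_map w (carpet_pt i)" for i
    define a where "a = cell_average u w"
    have V: "cell_vertices w = g ` {..<8}" by (auto simp: cell_vertices_def g_def)
    have "(\<Sum>(p, q) \<in> {(p, q). p \<in> cell_vertices w \<and> q \<in> cell_vertices w \<and> norm (p - q) = 1 / (2 * 3 ^ n)}. (u p - u q)\<^sup>2)
        \<le> (\<Sum>(p, q) \<in> g ` {..<8} \<times> g ` {..<8}. (u p - u q)\<^sup>2)"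
      by (rule sum_mono2) (auto simp: V)
    also have "g ` {..<8} \<times> g ` {..<8} = (\<lambda>(i,k). (g i, g k)) ` ({..<8} \<times> {..<8})" by auto
    also have "(\<Sum>(p, q) \<in> (\<lambda>(i,k). (g i, g k)) ` ({..<8} \<times> {..<8}). (u p - u q)\<^sup>2) \<le>
        (\<Sum>(i,k) \<in> {..<8} \<times> {..<8}. (u (g i) - u (g k))\<^sup>2)"
      by (rule order_trans[OF sum_image_le]) (auto simp: case_prod_unfold)
    also have "\<dots> \<le> (\<Sum>(i,k) \<in> {..<8::nat} \<times> {..<8::nat}. 2 * (u (g i) - a)\<^sup>2 + 2 * (u (g k) - a)\<^sup>2)"
    proof (rule sum_mono, clarify)
      fix i k
      show "(u (g i) - u (g k))\<^sup>2 \<le> 2 * (u (g i) - a)\<^sup>2 + 2 * (u (g k) - a)\<^sup>2"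
        using square_add_le2[of "u (g i) - a" "a - u (g k)"] by (simp add: power2_commute)
    qed
    also have "\<dots> = 2 * (8 * (\<Sum>i<8. 2 * (u (g i) - a)\<^sup>2))"
      by (simp add: sum.cartesian_product[symmetric] sum.distrib sum_distrib_left)
    finally show ?thesis by (simp add: g_def a_def)
  qed
  then show ?thesis unfolding level_energy_def r sum_distrib_left[of 8]
    by (intro mult_left_mono sum_mono) auto
qed

section \<open>The discrete energy is bounded by the integral energy\<close>

text \<open>
  A pair of points shares a cell of level \<open>m\<close> only if \<open>norm (x - y) \<le> 2/3^m\<close>, and then at most 25 of them. So the pair is counted
  with the truncated geometric series over these \<open>m\<close>.
\<close>

lemma cell_overlap_kernel:
  fixes D s :: real
  assumes "s > 0" "D \<ge> 0" "x = y \<Longrightarrow> D = 0"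
  shows "(\<Sum>m. ennreal ((3 powr s) ^ m) * (\<Sum>w\<in>words m. ennreal D * (indicator (cell w) x * indicator (cell w) y)))
    \<le> ennreal (25 * (3 powr s / (3 powr s - 1)) * 2 powr s) *
       (ennreal (D / norm (x - y) powr s) * (indicator carpet x * indicator carpet y))"
proof (cases "x = y \<or> x \<notin> carpet \<or> y \<notin> carpet")
  case True
  have "ennreal D * (indicator (cell w) x * indicator (cell w) y) = 0" if "w \<in> words m" for w m
    using True cell_subset_carpet[OF that] assms by (auto split: split_indicator)
  then have "(\<Sum>w\<in>words m. ennreal D * (indicator (cell w) x * indicator (cell w) y)) = 0" for m
    by (intro sum.neutral) blast
  then show ?thesis by simp
next
  case False
  then have xy: "x \<noteq> y" "x \<in> carpet" "y \<in> carpet" by auto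
  define d where "d = norm (x - y)"
  have "d > 0" using xy by (simp add: d_def)
  have a: "3 powr s > 1" using \<open>s > 0\<close> by simp
  have "(\<Sum>w\<in>words m. ennreal D * (indicator (cell w) x * indicator (cell w) y))
      \<le> ennreal (25 * D) * of_bool (3 ^ m \<le> 2 / d)" for m
  proof (cases "3 ^ m \<le> 2 / d")
    case True
    have "(\<Sum>w\<in>words m. ennreal D * (indicator (cell w) x * indicator (cell w) y))
        \<le> (\<Sum>w\<in>words m. ennreal D * indicator {w\<in>words m. x \<in> cell w} w)"
      by (intro sum_mono mult_left_mono) (auto split: split_indicator)
    also have "\<dots> = ennreal D * of_nat (card {w\<in>words m. x \<in> cell w})"
      by (subst sum_distrib_left[symmetric])
         (simp add: sum.If_cases indicator_def finite_words of_bool_def Int_def)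
    also have "\<dots> \<le> ennreal D * of_nat 25"
      using card_cells_containing[of m x] by (intro mult_left_mono) (metis of_nat_mono, simp)
    finally show ?thesis using True \<open>D \<ge> 0\<close> by (simp add: ennreal_mult' mult.commute)
  next
    case False
    have "ennreal D * (indicator (cell w) x * indicator (cell w) y) = 0" if "w \<in> words m" for w
    proof (rule ccontr)
      assume "\<not> ?thesis"
      then have "x \<in> cell w" "y \<in> cell w" by (auto split: split_indicator_asm)
      then have "d \<le> 2 / 3 ^ m" using cell_dist length_words[OF that] by (metis d_def dist_norm)
      then show False using False \<open>d > 0\<close> by (simp add: field_simps)
    qed
    then have "(\<Sum>w\<in>words m. ennreal D * (indicator (cell w) x * indicator (cell w) y)) = 0"
      by (intro sum.neutral) blast
    then show ?thesis by simp
  qed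
  then have "(\<Sum>m. ennreal ((3 powr s) ^ m) * (\<Sum>w\<in>words m. ennreal D * (indicator (cell w) x * indicator (cell w) y)))
    \<le> (\<Sum>m. ennreal (25 * D) * (ennreal ((3 powr s) ^ m) * of_bool (3 ^ m \<le> 2 / d)))"
    by (subst mult.left_commute) (intro suminf_le allI mult_left_mono, auto)
  also have "\<dots> = ennreal (25 * D) * (\<Sum>m. ennreal ((3 powr s) ^ m) * of_bool (3 ^ m \<le> 2 / d))" by simp
  also have "\<dots> \<le> ennreal (25 * D) * ennreal (3 powr s / (3 powr s - 1) * (2 / d) powr s)"
    using \<open>s > 0\<close> \<open>d > 0\<close> by (intro mult_left_mono truncated_geometric_sum) auto
  also have "\<dots> = ennreal (25 * (3 powr s / (3 powr s - 1)) * 2 powr s) * ennreal (D / d powr s)"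
    using a \<open>D \<ge> 0\<close> \<open>d > 0\<close> by (simp add: ennreal_mult'[symmetric] powr_divide)
  finally show ?thesis using xy by (simp add: d_def)
qed

lemma sum_cell_energy_le_besov:
  fixes u :: "real^2 \<Rightarrow> real"
  assumes [measurable]: "u \<in> borel_measurable borel" and s: "s = carpet_dim + \<beta>" "s > 0"
  shows "(\<Sum>m. ennreal ((3 powr s) ^ m) * (\<Sum>w\<in>words m. cell_energy u w w))
    \<le> ennreal (25 * (3 powr s / (3 powr s - 1)) * 2 powr s) * besov_energy \<beta> u"
proof -
  let ?C = "ennreal (25 * (3 powr s / (3 powr s - 1)) * 2 powr s)"
  let ?g = "\<lambda>w x y. ennreal ((u x - u y)\<^sup>2) * (indicator (cell w) x * indicator (cell w) y) :: ennreal"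
  have "ennreal ((3 powr s) ^ m) * (\<Sum>w\<in>words m. cell_energy u w w) =
    (\<integral>\<^sup>+x. \<integral>\<^sup>+y. ennreal ((3 powr s) ^ m) * (\<Sum>w\<in>words m. ?g w x y) \<partial>carpet_measure \<partial>carpet_measure)" for m
    unfolding cell_energy_def by (simp add: nn_integral_sum nn_integral_cmult)
  then have "(\<Sum>m. ennreal ((3 powr s) ^ m) * (\<Sum>w\<in>words m. cell_energy u w w)) =
    (\<Sum>m. \<integral>\<^sup>+x. \<integral>\<^sup>+y. ennreal ((3 powr s) ^ m) * (\<Sum>w\<in>words m. ?g w x y) \<partial>carpet_measure \<partial>carpet_measure)"
    by simp
  also have "\<dots> = (\<integral>\<^sup>+x. \<integral>\<^sup>+y. (\<Sum>m. ennreal ((3 powr s) ^ m) * (\<Sum>w\<in>words m. ?g w x y)) \<partial>carpet_measure \<partial>carpet_measure)"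
    by (simp add: nn_integral_suminf del: ennreal_suminf_cmult)
  also have "\<dots> \<le> (\<integral>\<^sup>+x. \<integral>\<^sup>+y. ?C * (ennreal ((u x - u y)\<^sup>2 / norm (x - y) powr s) *
        (indicator carpet x * indicator carpet y)) \<partial>carpet_measure \<partial>carpet_measure)"
    by (intro nn_integral_mono cell_overlap_kernel s) auto
  also have "\<dots> = ?C * besov_energy \<beta> u"
    unfolding besov_energy_alt s(1)[symmetric] by (simp add: nn_integral_cmult)
  finally show ?thesis .
qed

text \<open>
  Every vertex \<open>word_map w (carpet_pt i)\<close> is the limit of the shrinking cells of the words \<open>w @ replicate l i\<close>, by continuity its
  value is the limit of the averages of \<open>u\<close> over them. Telescoping along these averages bounds the deviation of the vertex values
  from the average over \<open>cell w\<close>.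
\<close>

lemma discrete_le_besov:
  assumes \<beta>: "\<beta> > carpet_dim"
  shows "\<exists>C\<ge>0. \<forall>u. continuous_on carpet u \<longrightarrow> u \<in> borel_measurable borel \<longrightarrow>
    discrete_energy \<beta> u \<le> ennreal C * besov_energy \<beta> u"
proof -
  define r where "r = 3 powr (\<beta> - carpet_dim)"
  have "r > 1" using \<beta> by (simp add: r_def)
  \<comment> \<open>The loss \<open>1 + e\<close> per telescoping step has to stay below the ratio \<open>r\<close> of the weights; this is where \<open>\<beta> > carpet_dim\<close> enters.\<close>
  define e where "e = (r - 1) / 2"
  have e: "e > 0" "1 + e < r" using \<open>r > 1\<close> by (auto simp: e_def field_simps)
  define s where "s = carpet_dim + \<beta>"
  have "s > 0" using \<beta> carpet_dim_pos by (simp add: s_def)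
  have rs: "r ^ m * 64 ^ m = (3 powr s) ^ m" for m
    unfolding r_def s_def by (rule power_weight_eq[symmetric])
  define c where "c = (1 + 1 / e) * 64"
  have "c \<ge> 0" using e by (simp add: c_def)
  define K where "K = 25 * (3 powr s / (3 powr s - 1)) * 2 powr s"
  have "3 powr s > 1" using \<open>s > 0\<close> by simp
  then have "K \<ge> 0" by (simp add: K_def)
  define T where "T = 2 * (r / (r - (1 + e)))"
  have "T \<ge> 0" using e \<open>r > 1\<close> by (simp add: T_def)
  have "discrete_energy \<beta> u \<le> ennreal (16 * T * c * K) * besov_energy \<beta> u"
    if cont: "continuous_on carpet u" and meas: "u \<in> borel_measurable borel" for u
  proof -
    define a where "a = cell_average u"
    define H where "H l n = (\<Sum>w\<in>words n. \<Sum>i<8. (a w - a (w @ replicate l i))\<^sup>2)" for l n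
    define X where "X n = (\<Sum>w\<in>words n. \<Sum>i<8. (u (word_map w (carpet_pt i)) - a w)\<^sup>2)" for n
    define E where "E l n = (\<Sum>w\<in>words n. \<Sum>i<8. 2 * (u (word_map w (carpet_pt i)) - a (w @ replicate l i))\<^sup>2)" for l n
    define d where "d n = ennreal (c * 64 ^ n) * (\<Sum>w\<in>words n. cell_energy u w w)" for n
    have H_nonneg: "H l n \<ge> 0" for l n by (simp add: H_def sum_nonneg)
    have "(\<Sum>n. ennreal (r ^ n) * ennreal (X n)) \<le> ennreal T * (\<Sum>m. ennreal (r ^ m) * d m)"
      unfolding T_def
    proof (rule telescoping_series)
      show "ennreal (H 0 n) = 0" for n by (simp add: H_def)
      show "ennreal (H (Suc l) n) \<le> ennreal (1 + e) * ennreal (H l (Suc n)) + d n" for l n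
      proof -
        have "H (Suc l) n \<le> (\<Sum>w\<in>words n. \<Sum>i<8. (1 + e) * (a (w @ [i]) - a ((w @ [i]) @ replicate l i))\<^sup>2
            + (1 + 1 / e) * (a w - a (w @ [i]))\<^sup>2)"
          unfolding H_def
        proof (intro sum_mono)
          fix w i
          show "(a w - a (w @ replicate (Suc l) i))\<^sup>2 \<le> (1 + e) * (a (w @ [i]) - a ((w @ [i]) @ replicate l i))\<^sup>2
            + (1 + 1 / e) * (a w - a (w @ [i]))\<^sup>2"
            using square_add_le[OF e(1), of "a (w @ [i]) - a ((w @ [i]) @ replicate l i)" "a w - a (w @ [i])"]
            by simp
        qed
        also have "\<dots> = (1 + e) * (\<Sum>w\<in>words n. \<Sum>i<8. (a (w @ [i]) - a ((w @ [i]) @ replicate l i))\<^sup>2) +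
            (1 + 1 / e) * (\<Sum>w\<in>words n. \<Sum>i<8. (a w - a (w @ [i]))\<^sup>2)"
          by (simp add: sum.distrib sum_distrib_left)
        also have "(\<Sum>w\<in>words n. \<Sum>i<8. (a (w @ [i]) - a ((w @ [i]) @ replicate l i))\<^sup>2) \<le> H l (Suc n)"
          unfolding H_def sum_words_Suc
        proof (intro sum_mono)
          fix w i assume "i \<in> {..<8::nat}"
          then show "(a (w @ [i]) - a ((w @ [i]) @ replicate l i))\<^sup>2
              \<le> (\<Sum>k<8. (a (w @ [i]) - a ((w @ [i]) @ replicate l k))\<^sup>2)"
            by (intro member_le_sum) auto
        qed
        finally have "H (Suc l) n \<le> (1 + e) * H l (Suc n) +
            (1 + 1 / e) * (\<Sum>w\<in>words n. \<Sum>i<8. (a w - a (w @ [i]))\<^sup>2)"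
          using e by simp
        then have "ennreal (H (Suc l) n) \<le> ennreal ((1 + e) * H l (Suc n) +
            (1 + 1 / e) * (\<Sum>w\<in>words n. \<Sum>i<8. (a w - a (w @ [i]))\<^sup>2))"
          by (rule ennreal_leI)
        also have "\<dots> = ennreal (1 + e) * ennreal (H l (Suc n)) +
            ennreal (1 + 1 / e) * (\<Sum>w\<in>words n. \<Sum>i<8. ennreal ((a w - a (w @ [i]))\<^sup>2))"
          using e H_nonneg by (simp add: ennreal_mult sum_nonneg)
        also have "\<dots> \<le> ennreal (1 + e) * ennreal (H l (Suc n)) +
            ennreal (1 + 1 / e) * (\<Sum>w\<in>words n. \<Sum>i<8::nat. ennreal (8 * 64 ^ n) * cell_energy u w w)"
          unfolding a_def by (intro add_left_mono mult_left_mono sum_mono cell_average_diff_le[OF cont meas]) auto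
        also have "(\<Sum>w\<in>words n. \<Sum>i<8::nat. ennreal (8 * 64 ^ n) * cell_energy u w w) =
            ennreal (64 * 64 ^ n) * (\<Sum>w\<in>words n. cell_energy u w w)"
        proof -
          have "(\<Sum>i<8::nat. ennreal (8 * 64 ^ n) * z) = ennreal (64 * 64 ^ n) * z" for z
            by (simp add: mult.assoc[symmetric] ennreal_mult')
          then show ?thesis by (simp only: sum_distrib_left)
        qed
        also have "ennreal (1 + 1 / e) * \<dots> = d n"
        proof -
          have "ennreal (1 + 1 / e) * ennreal (64 * 64 ^ n) = ennreal ((1 + 1 / e) * (64 * 64 ^ n))"
            by (rule ennreal_mult[symmetric]) (use e in auto)
          then show ?thesis by (simp only: d_def c_def mult.assoc[symmetric])
        qed
        finally show ?thesis .
      qed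
      show "ennreal (X n) \<le> ennreal 2 * ennreal (H l n) + ennreal (E l n)" for l n
      proof -
        have "X n \<le> (\<Sum>w\<in>words n. \<Sum>i<8. 2 * (a w - a (w @ replicate l i))\<^sup>2 +
            2 * (u (word_map w (carpet_pt i)) - a (w @ replicate l i))\<^sup>2)"
          unfolding X_def
        proof (intro sum_mono)
          fix w i
          show "(u (word_map w (carpet_pt i)) - a w)\<^sup>2 \<le> 2 * (a w - a (w @ replicate l i))\<^sup>2 +
            2 * (u (word_map w (carpet_pt i)) - a (w @ replicate l i))\<^sup>2"
            using square_add_le2[of "u (word_map w (carpet_pt i)) - a (w @ replicate l i)" "a (w @ replicate l i) - a w"]
            by (simp add: power2_commute)
        qed
        also have "\<dots> = 2 * H l n + E l n"
          by (simp add: H_def E_def sum.distrib sum_distrib_left)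
        finally have "ennreal (X n) \<le> ennreal (2 * H l n + E l n)" by (rule ennreal_leI)
        also have "\<dots> = ennreal 2 * ennreal (H l n) + ennreal (E l n)"
          using H_nonneg[of l n] by (simp add: ennreal_mult' E_def sum_nonneg del: ennreal_numeral)
        finally show ?thesis .
      qed
      show "(\<lambda>l. ennreal (E l n)) \<longlonglongrightarrow> 0" for n
      proof -
        have lim: "(\<lambda>l. a (w @ replicate l i)) \<longlonglongrightarrow> u (word_map w (carpet_pt i))"
          if w: "w \<in> words n" and i: "i < 8" for w i
        proof (rule LIMSEQ_I)
          fix \<epsilon> :: real assume "0 < \<epsilon>"
          then obtain N where N: "\<And>n w x y. n \<ge> N \<Longrightarrow> w \<in> words n \<Longrightarrow> x \<in> cell w \<Longrightarrow> y \<in> cell w \<Longrightarrow> \<bar>u x - u y\<bar> \<le> \<epsilon>/2"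
            using carpet_oscillation[OF cont, of "\<epsilon>/2"] by (metis half_gt_zero)
          have "norm (a (w @ replicate l i) - u (word_map w (carpet_pt i))) < \<epsilon>" if "l \<ge> N" for l
          proof -
            have mem: "w @ replicate l i \<in> words (n + l)" using w i by (rule append_replicate_in_words)
            have "word_map w (carpet_pt i) = word_map (w @ replicate l i) (carpet_pt i)"
              by (simp add: word_map_append)
            then have v: "word_map w (carpet_pt i) \<in> cell (w @ replicate l i)"
              using vertex_in_cell[OF i, of "w @ replicate l i"] by simp
            have "(a (w @ replicate l i) - u (word_map w (carpet_pt i)))\<^sup>2 \<le> (\<epsilon>/2)\<^sup>2"
              unfolding a_def
            proof (rule cell_average_close[OF cont meas mem])
              show "\<bar>u x - u (word_map w (carpet_pt i))\<bar> \<le> \<epsilon>/2" if "x \<in> cell (w @ replicate l i)" for x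
                using N[OF _ mem that v] \<open>l \<ge> N\<close> by simp
            qed (use \<open>0 < \<epsilon>\<close> in simp)
            then have "\<bar>a (w @ replicate l i) - u (word_map w (carpet_pt i))\<bar> \<le> \<bar>\<epsilon>/2\<bar>"
              by (simp only: abs_le_square_iff)
            then show ?thesis using \<open>0 < \<epsilon>\<close> by simp
          qed
          then show "\<exists>no. \<forall>l\<ge>no. norm (a (w @ replicate l i) - u (word_map w (carpet_pt i))) < \<epsilon>" by blast
        qed
        have "(\<lambda>l. E l n) \<longlonglongrightarrow> (\<Sum>w\<in>words n. \<Sum>i<8. 2 * (u (word_map w (carpet_pt i)) - u (word_map w (carpet_pt i)))\<^sup>2)"
          unfolding E_def by (intro tendsto_intros lim) auto
        then have "(\<lambda>l. E l n) \<longlonglongrightarrow> 0" by simp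
        from tendsto_ennrealI[OF this] show ?thesis by simp
      qed
    qed (use e in auto)
    also have "(\<Sum>m. ennreal (r ^ m) * d m) =
        ennreal c * (\<Sum>m. ennreal ((3 powr s) ^ m) * (\<Sum>w\<in>words m. cell_energy u w w))"
    proof -
      have "ennreal (r ^ m) * d m = ennreal c * (ennreal ((3 powr s) ^ m) * (\<Sum>w\<in>words m. cell_energy u w w))" for m
      proof -
        have "ennreal (r ^ m) * ennreal (c * 64 ^ m) = ennreal (r ^ m * (c * 64 ^ m))"
          by (rule ennreal_mult[symmetric]) (use \<open>c \<ge> 0\<close> \<open>r > 1\<close> in auto)
        also have "r ^ m * (c * 64 ^ m) = c * (3 powr s) ^ m"
          unfolding rs[symmetric] by (simp only: ac_simps)
        also have "ennreal (c * (3 powr s) ^ m) = ennreal c * ennreal ((3 powr s) ^ m)"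
          by (rule ennreal_mult) (use \<open>c \<ge> 0\<close> in auto)
        finally show ?thesis unfolding d_def mult.assoc[symmetric] by (rule arg_cong)
      qed
      then show ?thesis by simp
    qed
    also have "\<dots> \<le> ennreal c * (ennreal K * besov_energy \<beta> u)"
      unfolding K_def
      by (intro mult_left_mono sum_cell_energy_le_besov[OF meas s_def \<open>s > 0\<close>]) auto
    finally have bound: "(\<Sum>n. ennreal (r ^ n) * ennreal (X n)) \<le> ennreal T * (ennreal c * (ennreal K * besov_energy \<beta> u))"
      by (simp add: mult_left_mono)
    have "discrete_energy \<beta> u \<le> (\<Sum>n. ennreal (level_energy \<beta> n u))"
      unfolding discrete_energy_def
      using suminf_shift_le_ennreal[of "\<lambda>n. ennreal (level_energy \<beta> n u)" 1] by simp
    also have "\<dots> \<le> (\<Sum>n. ennreal 16 * (ennreal (r ^ n) * ennreal (X n)))"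
    proof (intro suminf_le allI)
      fix n
      have "level_energy \<beta> n u \<le> 16 * (r ^ n * X n)"
        using level_energy_le_cell_average[of \<beta> n u]
        by (simp add: r_def X_def a_def sum_distrib_left[symmetric] ac_simps)
      then have "ennreal (level_energy \<beta> n u) \<le> ennreal (16 * (r ^ n * X n))" by (rule ennreal_leI)
      also have "\<dots> = ennreal 16 * (ennreal (r ^ n) * ennreal (X n))"
        using \<open>r > 1\<close> by (simp add: ennreal_mult' del: ennreal_numeral)
      finally show "ennreal (level_energy \<beta> n u) \<le> ennreal 16 * (ennreal (r ^ n) * ennreal (X n))" .
    qed auto
    also have "\<dots> = ennreal 16 * (\<Sum>n. ennreal (r ^ n) * ennreal (X n))"
      by (rule ennreal_suminf_cmult)
    also have "\<dots> \<le> ennreal 16 * (ennreal T * (ennreal c * (ennreal K * besov_energy \<beta> u)))"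
      by (rule mult_left_mono[OF bound]) simp
    also have "\<dots> = ennreal (16 * T * c * K) * besov_energy \<beta> u"
      using \<open>T \<ge> 0\<close> \<open>c \<ge> 0\<close> \<open>K \<ge> 0\<close> by (simp add: ennreal_mult mult.assoc del: ennreal_numeral)
    finally show ?thesis .
  qed
  moreover have "16 * T * c * K \<ge> 0" using \<open>T \<ge> 0\<close> \<open>c \<ge> 0\<close> \<open>K \<ge> 0\<close> by simp
  ultimately show ?thesis by blast
qed

section \<open>Oscillation on a cell in terms of its edges\<close>

lemma abs_diff_le_variation:
  fixes h :: "nat \<Rightarrow> real"
  assumes "k \<le> N" "l \<le> N"
  shows "\<bar>h k - h l\<bar> \<le> (\<Sum>j<N. \<bar>h j - h (Suc j)\<bar>)"
proof -
  have *: "\<bar>h k - h l\<bar> \<le> (\<Sum>j<N. \<bar>h j - h (Suc j)\<bar>)" if "k \<le> l" "l \<le> N" for k l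
  proof -
    have "\<bar>h k - h l\<bar> \<le> (\<Sum>j=k..<l. \<bar>h j - h (Suc j)\<bar>)"
      using \<open>k \<le> l\<close> by (induction l rule: dec_induct) auto
    also have "\<dots> \<le> (\<Sum>j<N. \<bar>h j - h (Suc j)\<bar>)"
      using that by (intro sum_mono2) auto
    finally show ?thesis .
  qed
  show ?thesis using *[of k l] *[of l k] assms by (cases "k \<le> l") (auto simp: abs_minus_commute)
qed

text \<open>
  The boundary of a cell is a cycle of eight edges, of which the seven that form a path suffice to compare all its vertices.
\<close>

definition edge_energy :: "(real^2 \<Rightarrow> real) \<Rightarrow> nat list \<Rightarrow> real" where
  "edge_energy u w = (\<Sum>k<7. (u (word_map w (carpet_pt k)) - u (word_map w (carpet_pt (Suc k))))\<^sup>2)"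

lemma edge_energy_nonneg: "edge_energy u w \<ge> 0"
  by (simp add: edge_energy_def sum_nonneg)

lemma norm_carpet_edge:
  assumes "k < 7"
  shows "norm (carpet_pt k - carpet_pt (Suc k)) = 1 / 2"
proof -
  have "k = 0 \<or> k = 1 \<or> k = 2 \<or> k = 3 \<or> k = 4 \<or> k = 5 \<or> k = 6" using assms by auto
  moreover have "sqrt (1 / 4) = 1 / 2" by (rule real_sqrt_unique) (auto simp: power2_eq_square)
  ultimately show ?thesis
    by (elim disjE) (simp_all add: carpet_pt_def norm_vec_def L2_set_def sum_2 numeral_eq_Suc)
qed

lemma edge_energy_le_level_energy:
  "(3 powr (\<beta> - carpet_dim)) ^ n * (\<Sum>w\<in>words n. edge_energy u w) \<le> 14 * level_energy \<beta> n u"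
proof -
  have r: "3 powr ((\<beta> - carpet_dim) * real n) = (3 powr (\<beta> - carpet_dim)) ^ n"
    by (simp add: powr_realpow[symmetric] powr_powr)
  have "edge_energy u w \<le> 14 *
    ((\<Sum>(p, q) \<in> {(p, q). p \<in> cell_vertices w \<and> q \<in> cell_vertices w \<and> norm (p - q) = 1 / (2 * 3 ^ n)}.
             (u p - u q)\<^sup>2) / 2)" if w: "w \<in> words n" for w
  proof -
    let ?P = "{(p, q). p \<in> cell_vertices w \<and> q \<in> cell_vertices w \<and> norm (p - q) = 1 / (2 * 3 ^ n)}"
    have fin: "finite ?P"
      by (rule finite_subset[of _ "cell_vertices w \<times> cell_vertices w"]) (auto simp: cell_vertices_def)
    have "edge_energy u w \<le> (\<Sum>k<7::nat. (\<Sum>(p, q) \<in> ?P. (u p - u q)\<^sup>2))"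
      unfolding edge_energy_def
    proof (rule sum_mono)
      fix k assume "k \<in> {..<7::nat}"
      then have "(word_map w (carpet_pt k), word_map w (carpet_pt (Suc k))) \<in> ?P"
        using w by (auto simp: cell_vertices_def word_map_diff length_words norm_carpet_edge)
      then show "(u (word_map w (carpet_pt k)) - u (word_map w (carpet_pt (Suc k))))\<^sup>2 \<le>
          (\<Sum>(p, q) \<in> ?P. (u p - u q)\<^sup>2)"
        using member_le_sum[OF _ _ fin, of _ "\<lambda>(p, q). (u p - u q)\<^sup>2"] by fastforce
    qed
    then show ?thesis by simp
  qed
  then have "(\<Sum>w\<in>words n. edge_energy u w) \<le> (\<Sum>w\<in>words n. 14 *
    ((\<Sum>(p, q) \<in> {(p, q). p \<in> cell_vertices w \<and> q \<in> cell_vertices w \<and> norm (p - q) = 1 / (2 * 3 ^ n)}.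
             (u p - u q)\<^sup>2) / 2))"
    by (rule sum_mono)
  then show ?thesis
    unfolding level_energy_def r sum_distrib_left[symmetric]
    by (subst mult.left_commute) (intro mult_left_mono, auto)
qed

text \<open>
  The eight subcells of a cell form a ring, and consecutive ones share a vertex. So the path of at most \<open>8 * 7 = 56\<close> edges of subcells
  connects any two of their vertices, and the Cauchy-Schwarz inequality yields the constant.
\<close>

lemma subcell_vertex_diff:
  assumes "i < 8" "k < 8"
  shows "(u (word_map (w @ [i]) (carpet_pt k)) - u (word_map w (carpet_pt 0)))\<^sup>2
     \<le> 56 * (\<Sum>j<8. edge_energy u (w @ [j]))"
proof -
  define g where "g i k = u (word_map (w @ [i]) (carpet_pt k))" for i k
  define s where "s i = (\<Sum>k<7. \<bar>g i k - g i (Suc k)\<bar>)" for i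
  have inner: "\<bar>g i k - g i l\<bar> \<le> s i" if "k < 8" "l < 8" for i k l
    unfolding s_def using that by (intro abs_diff_le_variation) auto
  have path: "\<bar>g i k - g 0 0\<bar> \<le> (\<Sum>j<Suc i. s j)" if "i < 8" "k < 8" for i k
    using that
  proof (induction i arbitrary: k)
    case 0
    then show ?case using inner[of k 0 0] by simp
  next
    case (Suc i)
    have "i = 0 \<or> i = 1 \<or> i = 2 \<or> i = 3 \<or> i = 4 \<or> i = 5 \<or> i = 6" using Suc by auto
    then have "touching [i] [Suc i]"
      by (auto simp: touching_def pt_col_def pt_row_def numeral_eq_Suc)
    moreover have "[i] \<in> words 1" "[Suc i] \<in> words 1" using Suc by (auto simp: words_def)
    ultimately obtain a b where ab: "a < 8" "b < 8"
        "word_map [i] (carpet_pt a) = word_map [Suc i] (carpet_pt b)"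
      using touching_share_vertex by blast
    then have "g i a = g (Suc i) b" by (simp add: g_def word_map_append)
    then have "\<bar>g (Suc i) k - g 0 0\<bar> \<le> \<bar>g (Suc i) k - g (Suc i) b\<bar> + \<bar>g i a - g 0 0\<bar>" by simp
    also have "\<dots> \<le> s (Suc i) + (\<Sum>j<Suc i. s j)"
      using inner ab Suc by (intro add_mono) auto
    finally show ?case by simp
  qed
  have "\<bar>g i k - g 0 0\<bar> \<le> (\<Sum>j<Suc i. s j)" by (rule path[OF assms])
  also have "\<dots> \<le> (\<Sum>j<8. s j)"
    using assms by (intro sum_mono2) (auto simp: s_def sum_nonneg)
  also have "\<dots> = (\<Sum>(j,k)\<in>{..<8} \<times> {..<7}. \<bar>g j k - g j (Suc k)\<bar>)"
    unfolding s_def by (rule sum.cartesian_product)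
  finally have "\<bar>g i k - g 0 0\<bar>\<^sup>2 \<le> (\<Sum>(j,k)\<in>{..<8} \<times> {..<7}. \<bar>g j k - g j (Suc k)\<bar>)\<^sup>2"
    by (rule power_mono) simp
  also have "\<dots> \<le> (\<Sum>z\<in>{..<8::nat} \<times> {..<7::nat}. (case z of (j,k) \<Rightarrow> \<bar>g j k - g j (Suc k)\<bar>)\<^sup>2) * card ({..<8::nat} \<times> {..<7::nat})"
    by (rule sum_squared_le_sum_of_squares)
  also have "\<dots> = 56 * (\<Sum>(j,k)\<in>{..<8} \<times> {..<7}. (g j k - g j (Suc k))\<^sup>2)"
    by (simp add: card_cartesian_product case_prod_unfold)
  also have "(\<Sum>(j,k)\<in>{..<8} \<times> {..<7}. (g j k - g j (Suc k))\<^sup>2) = (\<Sum>j<8. edge_energy u (w @ [j]))"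
    unfolding edge_energy_def g_def by (rule sum.cartesian_product[symmetric])
  finally have "(g i k - g 0 0)\<^sup>2 \<le> 56 * (\<Sum>j<8. edge_energy u (w @ [j]))" by simp
  moreover have "g 0 0 = u (word_map w (carpet_pt 0))"
    by (simp add: g_def word_map_append)
  ultimately show ?thesis by (simp add: g_def)
qed

lemma vertex_diff:
  assumes "i < 8"
  shows "(u (word_map w (carpet_pt i)) - u (word_map w (carpet_pt 0)))\<^sup>2
     \<le> 56 * (\<Sum>j<8. edge_energy u (w @ [j]))"
  using subcell_vertex_diff[OF assms assms, of u w] by (simp add: word_map_append)

definition vertex_deviation :: "(real^2 \<Rightarrow> real) \<Rightarrow> nat list \<Rightarrow> ennreal" where
  "vertex_deviation u w =
     (\<integral>\<^sup>+x. ennreal ((u x - u (word_map w (carpet_pt 0)))\<^sup>2) * indicator (cell w) x \<partial>carpet_measure)"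

text \<open>
  Replacing \<open>u\<close> on each subcell of depth \<open>l\<close> by its value at the first vertex of that subcell.
\<close>

lemma vertex_deviation_refine:
  fixes u :: "real^2 \<Rightarrow> real"
  assumes [measurable]: "u \<in> borel_measurable borel" and w: "w \<in> words n"
  shows "vertex_deviation u w \<le> (\<Sum>v\<in>words l. 2 * vertex_deviation u (w @ v) +
     ennreal (2 * (u (word_map (w @ v) (carpet_pt 0)) - u (word_map w (carpet_pt 0)))\<^sup>2 / 8 ^ (n + l)))"
proof -
  define c where "c v = u (word_map v (carpet_pt 0))" for v
  have "vertex_deviation u w \<le> (\<integral>\<^sup>+x. (\<Sum>v\<in>words l.
      2 * (ennreal ((u x - c (w @ v))\<^sup>2) * indicator (cell (w @ v)) x) +
      ennreal (2 * (c (w @ v) - c w)\<^sup>2) * indicator (cell (w @ v)) x) \<partial>carpet_measure)"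
    unfolding vertex_deviation_def c_def[symmetric]
  proof (rule nn_integral_mono)
    fix x
    show "ennreal ((u x - c w)\<^sup>2) * indicator (cell w) x \<le> (\<Sum>v\<in>words l.
      2 * (ennreal ((u x - c (w @ v))\<^sup>2) * indicator (cell (w @ v)) x) +
      ennreal (2 * (c (w @ v) - c w)\<^sup>2) * indicator (cell (w @ v)) x)"
    proof (cases "x \<in> cell w")
      case True
      then obtain v where v: "v \<in> words l" "x \<in> cell (w @ v)" using cell_cells[of w l] by blast
      have "(u x - c w)\<^sup>2 \<le> 2 * (u x - c (w @ v))\<^sup>2 + 2 * (c (w @ v) - c w)\<^sup>2"
        using square_add_le2[of "u x - c (w @ v)" "c (w @ v) - c w"] by simp
      then have "ennreal ((u x - c w)\<^sup>2) \<le> ennreal (2 * (u x - c (w @ v))\<^sup>2 + 2 * (c (w @ v) - c w)\<^sup>2)"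
        by (rule ennreal_leI)
      also have "\<dots> = 2 * (ennreal ((u x - c (w @ v))\<^sup>2) * indicator (cell (w @ v)) x) +
          ennreal (2 * (c (w @ v) - c w)\<^sup>2) * indicator (cell (w @ v)) x"
        using v by (simp add: ennreal_mult')
      also have "\<dots> \<le> (\<Sum>v\<in>words l.
          2 * (ennreal ((u x - c (w @ v))\<^sup>2) * indicator (cell (w @ v)) x) +
          ennreal (2 * (c (w @ v) - c w)\<^sup>2) * indicator (cell (w @ v)) x)"
        by (rule member_le_sum[OF v(1)]) (auto simp: finite_words)
      finally show ?thesis using True by simp
    qed simp
  qed
  also have "\<dots> = (\<Sum>v\<in>words l. 2 * vertex_deviation u (w @ v) +
      ennreal (2 * (c (w @ v) - c w)\<^sup>2) * emeasure carpet_measure (cell (w @ v)))"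
    unfolding vertex_deviation_def c_def
    by (subst nn_integral_sum) (auto simp: nn_integral_add nn_integral_cmult intro!: sum.cong)
  also have "\<dots> = (\<Sum>v\<in>words l. 2 * vertex_deviation u (w @ v) + ennreal (2 * (c (w @ v) - c w)\<^sup>2 / 8 ^ (n + l)))"
    using append_in_words[OF w]
    by (intro sum.cong refl) (simp add: emeasure_cell[of _ "n + l"] ennreal_mult'[symmetric])
  finally show ?thesis unfolding c_def .
qed

lemma vertex_deviation_small:
  fixes u :: "real^2 \<Rightarrow> real"
  assumes "v \<in> words n" "0 \<le> e" "\<And>x y. x \<in> cell v \<Longrightarrow> y \<in> cell v \<Longrightarrow> \<bar>u x - u y\<bar> \<le> e"
  shows "vertex_deviation u v \<le> ennreal (e\<^sup>2 / 8 ^ n)"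
proof -
  have "vertex_deviation u v \<le> (\<integral>\<^sup>+x. ennreal (e\<^sup>2) * indicator (cell v) x \<partial>carpet_measure)"
    unfolding vertex_deviation_def using assms vertex_in_cell[of 0 v]
    by (intro nn_integral_mono)
       (auto split: split_indicator intro!: ennreal_leI simp: abs_le_square_iff[symmetric])
  also have "\<dots> = ennreal (e\<^sup>2 / 8 ^ n)"
    by (subst nn_integral_cmult_indicator) (auto simp: emeasure_cell[OF assms(1)] ennreal_mult'[symmetric])
  finally show ?thesis .
qed

text \<open>
  Passing from \<open>x\<close> to \<open>y\<close> through the first vertex of \<open>w\<close>, the common vertex of \<open>w\<close> and \<open>v\<close>, and the first vertex of \<open>v\<close>.
\<close>

lemma touching_cell_energy:
  fixes u :: "real^2 \<Rightarrow> real"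
  assumes [measurable]: "u \<in> borel_measurable borel"
    and w: "w \<in> words n" and v: "v \<in> words n" and t: "touching w v"
  defines "\<phi> \<equiv> \<lambda>w. ennreal (4 / 8 ^ n) * vertex_deviation u w +
    ennreal (4 / 64 ^ n * (56 * (\<Sum>j<8. edge_energy u (w @ [j]))))"
  shows "cell_energy u w v \<le> \<phi> w + \<phi> v"
proof -
  define c where "c w = u (word_map w (carpet_pt 0))" for w
  define E where "E w = 56 * (\<Sum>j<8. edge_energy u (w @ [j]))" for w
  have E0: "E w \<ge> 0" for w by (simp add: E_def sum_nonneg edge_energy_nonneg)
  obtain i k where ik: "i < 8" "k < 8" "word_map w (carpet_pt i) = word_map v (carpet_pt k)"
    using touching_share_vertex[OF w v t] by blast
  define z where "z = u (word_map w (carpet_pt i))"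
  have zw: "(z - c w)\<^sup>2 \<le> E w" unfolding z_def c_def E_def by (rule vertex_diff) fact
  have zv: "(z - c v)\<^sup>2 \<le> E v" unfolding z_def c_def E_def ik(3) by (rule vertex_diff) fact
  have four: "(a + b + b' + a')\<^sup>2 \<le> 4 * a\<^sup>2 + 4 * b\<^sup>2 + 4 * b'\<^sup>2 + 4 * a'\<^sup>2" for a b b' a' :: real
    using square_add_le2[of "a + b" "b' + a'"] square_add_le2[of a b] square_add_le2[of b' a']
    by (simp add: add.assoc)
  have le: "(u x - u y)\<^sup>2 \<le> 4 * (u x - c w)\<^sup>2 + 4 * (u y - c v)\<^sup>2 + 4 * (E w + E v)" for x y
    using four[of "u x - c w" "c w - z" "z - c v" "c v - u y"] zw zv
    by (simp add: power2_commute)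
  let ?w = "indicator (cell w) :: _ \<Rightarrow> ennreal"
  let ?v = "indicator (cell v) :: _ \<Rightarrow> ennreal"
  have "cell_energy u w v \<le> (\<integral>\<^sup>+x. \<integral>\<^sup>+y.
      (ennreal 4 * (ennreal ((u x - c w)\<^sup>2) * ?w x)) * ?v y + ?w x * (ennreal 4 * (ennreal ((u y - c v)\<^sup>2) * ?v y))
      + ennreal (4 * (E w + E v)) * ?w x * ?v y \<partial>carpet_measure \<partial>carpet_measure)"
    unfolding cell_energy_def
  proof (intro nn_integral_mono)
    fix x y
    have "ennreal ((u x - u y)\<^sup>2) \<le> ennreal (4 * (u x - c w)\<^sup>2 + 4 * (u y - c v)\<^sup>2 + 4 * (E w + E v))"
      by (rule ennreal_leI[OF le])
    also have "\<dots> = ennreal 4 * ennreal ((u x - c w)\<^sup>2) + ennreal 4 * ennreal ((u y - c v)\<^sup>2) + ennreal (4 * (E w + E v))"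
      using E0 by (simp add: ennreal_mult')
    finally show "ennreal ((u x - u y)\<^sup>2) * (?w x * ?v y) \<le>
      (ennreal 4 * (ennreal ((u x - c w)\<^sup>2) * ?w x)) * ?v y + ?w x * (ennreal 4 * (ennreal ((u y - c v)\<^sup>2) * ?v y))
      + ennreal (4 * (E w + E v)) * ?w x * ?v y"
      by (auto split: split_indicator)
  qed
  also have "\<dots> = ennreal 4 * vertex_deviation u w * ennreal (1 / 8 ^ n) +
      ennreal (1 / 8 ^ n) * (ennreal 4 * vertex_deviation u v) +
      ennreal (4 * (E w + E v)) * ennreal (1 / 8 ^ n) * ennreal (1 / 8 ^ n)"
    unfolding vertex_deviation_def c_def
    by (simp add: nn_integral_add nn_integral_cmult nn_integral_multc emeasure_cell[OF w] emeasure_cell[OF v]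
        del: ennreal_numeral)
  also have "\<dots> = \<phi> w + \<phi> v"
  proof -
    have "ennreal (4 * (E w + E v)) * ennreal (1 / 8 ^ n) * ennreal (1 / 8 ^ n) =
       ennreal (4 / 64 ^ n * E w) + ennreal (4 / 64 ^ n * E v)"
      using E0 by (simp add: ennreal_mult'[symmetric] ennreal_plus[symmetric] field_simps
          power_mult_distrib[symmetric] del: ennreal_plus)
    moreover have "ennreal 4 * vertex_deviation u w * ennreal (1 / 8 ^ n) = ennreal (4 / 8 ^ n) * vertex_deviation u w" for w
      using ennreal_mult'[of 4 "1 / 8 ^ n"] by (simp add: ac_simps)
    moreover have "ennreal (1 / 8 ^ n) * (ennreal 4 * vertex_deviation u v) = ennreal (4 / 8 ^ n) * vertex_deviation u v" for v
      using ennreal_mult'[of 4 "1 / 8 ^ n"] by (simp add: ac_simps)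
    ultimately show ?thesis unfolding \<phi>_def E_def by (simp only: ac_simps)
  qed
  finally show ?thesis .
qed

lemma sum_touching_le:
  fixes \<phi> :: "nat list \<Rightarrow> ennreal"
  shows "(\<Sum>w\<in>words n. \<Sum>v\<in>{v\<in>words n. touching w v}. \<phi> w + \<phi> v) \<le> 18 * (\<Sum>w\<in>words n. \<phi> w)"
proof -
  have A: "(\<Sum>w\<in>words n. \<Sum>v\<in>{v\<in>words n. touching w v}. \<phi> w) \<le> 9 * (\<Sum>w\<in>words n. \<phi> w)"
    unfolding sum_distrib_left
  proof (rule sum_mono)
    fix w
    have "of_nat (card {v\<in>words n. touching w v}) \<le> (of_nat 9 :: ennreal)"
      using card_touching[of n w] of_nat_mono by blast
    then show "(\<Sum>v\<in>{v\<in>words n. touching w v}. \<phi> w) \<le> 9 * \<phi> w"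
      by (simp add: mult_right_mono)
  qed
  have "(\<Sum>w\<in>words n. \<Sum>v\<in>{v\<in>words n. touching w v}. \<phi> v) = (\<Sum>v\<in>words n. \<Sum>w\<in>{w\<in>words n. touching w v}. \<phi> v)"
    by (rule sum.swap_restrict) (auto simp: finite_words)
  also have "\<dots> = (\<Sum>w\<in>words n. \<Sum>v\<in>{v\<in>words n. touching w v}. \<phi> w)"
    by (simp add: touching_sym)
  also have "\<dots> \<le> 9 * (\<Sum>w\<in>words n. \<phi> w)" by (rule A)
  finally have B: "(\<Sum>w\<in>words n. \<Sum>v\<in>{v\<in>words n. touching w v}. \<phi> v) \<le> 9 * (\<Sum>w\<in>words n. \<phi> w)" .
  have "(\<Sum>w\<in>words n. \<Sum>v\<in>{v\<in>words n. touching w v}. \<phi> w + \<phi> v) \<le>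
      9 * (\<Sum>w\<in>words n. \<phi> w) + 9 * (\<Sum>w\<in>words n. \<phi> w)"
    unfolding sum.distrib by (rule add_mono[OF A B])
  also have "\<dots> = 18 * (\<Sum>w\<in>words n. \<phi> w)"
    unfolding distrib_right[symmetric] by simp
  finally show ?thesis .
qed

text \<open>
  For distinct points of the carpet the least \<open>n\<close> with \<open>1/3^(n+1) \<le> norm (x - y)\<close> is chosen. Then the kernel is at most
  \<open>(3 powr s)^(n+1)\<close>, and the points lie in touching cells of level \<open>n\<close>: for \<open>n = 0\<close> both lie in the carpet itself, and otherwise
  they are closer than \<open>1/3^n\<close> by minimality.
\<close>

lemma kernel_le_touching:
  fixes D s :: real
  assumes "s > 0" "D \<ge> 0"
  shows "ennreal (D / norm (x - y) powr s) * (indicator carpet x * indicator carpet y) \<le>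
    (\<Sum>n. ennreal ((3 powr s) ^ Suc n) * (\<Sum>w\<in>words n. \<Sum>v\<in>{v\<in>words n. touching w v}.
        ennreal D * (indicator (cell w) x * indicator (cell v) y)))"
proof (cases "x = y \<or> x \<notin> carpet \<or> y \<notin> carpet")
  case False
  then have xy: "x \<noteq> y" "x \<in> carpet" "y \<in> carpet" by auto
  define d where "d = norm (x - y)"
  have "d > 0" using xy by (simp add: d_def)
  have "\<forall>\<^sub>F m in sequentially. (1/3::real) ^ m < d"
    using \<open>d > 0\<close> by (intro order_tendstoD(2)[OF LIMSEQ_power_zero]) auto
  then obtain m :: nat where "(1/3::real) ^ m < d" by (auto simp: eventually_sequentially)
  moreover have "(1/3::real) ^ Suc m \<le> (1/3) ^ m" by simp
  ultimately have "(1/3::real) ^ Suc m \<le> d" by linarith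
  then have ex: "\<exists>m. (1/3::real) ^ Suc m \<le> d" by blast
  define n where "n = (LEAST m. (1/3::real) ^ Suc m \<le> d)"
  have n: "(1/3) ^ Suc n \<le> d" unfolding n_def using ex by (rule LeastI_ex)
  obtain w where w: "w \<in> words n" "x \<in> cell w" using carpet_cells[of n] xy by blast
  obtain v where v: "v \<in> words n" "y \<in> cell v" using carpet_cells[of n] xy by blast
  have t: "touching w v"
  proof (cases n)
    case 0
    then show ?thesis using w v by (simp add: touching_def)
  next
    case (Suc m)
    then have "\<not> (1/3) ^ Suc m \<le> d"
      using not_less_Least[of m "\<lambda>m. (1/3::real) ^ Suc m \<le> d"] by (simp add: n_def)
    then have "dist x y < 1 / 3 ^ n" by (simp add: Suc d_def dist_norm power_divide)
    then show ?thesis using near_cells_touch w v by blast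
  qed
  have "1 / d powr s \<le> (3 powr s) ^ Suc n"
  proof -
    have "(3 powr s) ^ Suc n = (3 ^ Suc n) powr s"
      by (simp only: powr_realpow[symmetric] powr_powr powr_gt_zero mult.commute zero_less_numeral)
    also have "\<dots> \<ge> (1 / d) powr s"
      using n \<open>d > 0\<close> \<open>s > 0\<close> by (intro powr_mono2) (auto simp: field_simps power_divide)
    finally show ?thesis using \<open>d > 0\<close> by (simp add: powr_divide)
  qed
  then have "D / d powr s \<le> (3 powr s) ^ Suc n * D"
    using mult_right_mono[OF _ \<open>D \<ge> 0\<close>] by fastforce
  then have "ennreal (D / d powr s) \<le> ennreal ((3 powr s) ^ Suc n * D)" by (rule ennreal_leI)
  also have "\<dots> = ennreal ((3 powr s) ^ Suc n) * (ennreal D * (indicator (cell w) x * indicator (cell v) y))"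
    using w v by (simp add: ennreal_mult')
  also have "\<dots> \<le> ennreal ((3 powr s) ^ Suc n) * (\<Sum>w\<in>words n. \<Sum>v\<in>{v\<in>words n. touching w v}.
        ennreal D * (indicator (cell w) x * indicator (cell v) y))"
  proof (rule mult_left_mono)
    have "ennreal D * (indicator (cell w) x * indicator (cell v) y) \<le> (\<Sum>v\<in>{v\<in>words n. touching w v}.
        ennreal D * (indicator (cell w) x * indicator (cell v) y))"
      by (rule member_le_sum) (use v t in \<open>auto simp: finite_words\<close>)
    also have "\<dots> \<le> (\<Sum>w\<in>words n. \<Sum>v\<in>{v\<in>words n. touching w v}.
        ennreal D * (indicator (cell w) x * indicator (cell v) y))"
      by (rule member_le_sum) (use w in \<open>auto simp: finite_words\<close>)
    finally show "ennreal D * (indicator (cell w) x * indicator (cell v) y) \<le> (\<Sum>w\<in>words n. \<Sum>v\<in>{v\<in>words n. touching w v}.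
        ennreal D * (indicator (cell w) x * indicator (cell v) y))" .
  qed simp
  also have "\<dots> \<le> (\<Sum>n. ennreal ((3 powr s) ^ Suc n) * (\<Sum>w\<in>words n. \<Sum>v\<in>{v\<in>words n. touching w v}.
        ennreal D * (indicator (cell w) x * indicator (cell v) y)))"
    using sum_le_suminf[of "\<lambda>n. ennreal ((3 powr s) ^ Suc n) * (\<Sum>w\<in>words n. \<Sum>v\<in>{v\<in>words n. touching w v}.
        ennreal D * (indicator (cell w) x * indicator (cell v) y))" "{n}"] by simp
  finally show ?thesis using xy by (simp add: d_def)
qed auto

section \<open>The integral energy is bounded by the discrete energy\<close>

lemma besov_le_touching_energy:
  fixes u :: "real^2 \<Rightarrow> real"
  assumes [measurable]: "u \<in> borel_measurable borel" and s: "s = carpet_dim + \<beta>" "s > 0"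
  shows "besov_energy \<beta> u \<le>
    (\<Sum>n. ennreal ((3 powr s) ^ Suc n) * (\<Sum>w\<in>words n. \<Sum>v\<in>{v\<in>words n. touching w v}. cell_energy u w v))"
proof -
  let ?g = "\<lambda>w v x y. ennreal ((u x - u y)\<^sup>2) * (indicator (cell w) x * indicator (cell v) y) :: ennreal"
  have "besov_energy \<beta> u \<le> (\<integral>\<^sup>+x. \<integral>\<^sup>+y. (\<Sum>n. ennreal ((3 powr s) ^ Suc n) *
      (\<Sum>w\<in>words n. \<Sum>v\<in>{v\<in>words n. touching w v}. ?g w v x y)) \<partial>carpet_measure \<partial>carpet_measure)"
    unfolding besov_energy_alt s(1)[symmetric]
    by (intro nn_integral_mono kernel_le_touching s) auto
  also have "\<dots> = (\<Sum>n. \<integral>\<^sup>+x. \<integral>\<^sup>+y. ennreal ((3 powr s) ^ Suc n) *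
      (\<Sum>w\<in>words n. \<Sum>v\<in>{v\<in>words n. touching w v}. ?g w v x y) \<partial>carpet_measure \<partial>carpet_measure)"
    by (simp add: nn_integral_suminf del: ennreal_suminf_cmult power_Suc)
  also have "\<dots> = (\<Sum>n. ennreal ((3 powr s) ^ Suc n) *
      (\<Sum>w\<in>words n. \<Sum>v\<in>{v\<in>words n. touching w v}. cell_energy u w v))"
    unfolding cell_energy_def by (simp add: nn_integral_sum nn_integral_cmult del: power_Suc)
  finally show ?thesis .
qed

text \<open>
  A Riemann sum with the subcells of depth \<open>l\<close>: as \<open>l\<close> grows it approaches \<open>8 ^ n\<close> times the sum of
  \<^const>\<open>vertex_deviation\<close> over the words of length \<open>n\<close>.
\<close>

definition vertex_spread :: "(real^2 \<Rightarrow> real) \<Rightarrow> nat \<Rightarrow> nat \<Rightarrow> real" where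
  "vertex_spread u l n = (\<Sum>w\<in>words n. \<Sum>v\<in>words l.
     (u (word_map (w @ v) (carpet_pt 0)) - u (word_map w (carpet_pt 0)))\<^sup>2) / 8 ^ l"

lemma vertex_spread_nonneg: "vertex_spread u l n \<ge> 0"
  by (simp add: vertex_spread_def sum_nonneg)

text \<open>
  The factor \<open>1/4\<close> is \<open>2/8\<close>: splitting the square costs 2, and each of the eight subcells has an eighth of the weight. It is below 1, so
  here the crude splitting into two equal parts is good enough for all \<open>\<beta>\<close>.
\<close>

lemma vertex_spread_Suc:
  "vertex_spread u (Suc l) n \<le> 1 / 4 * vertex_spread u l (Suc n) +
     112 * (\<Sum>w\<in>words (Suc n). edge_energy u w)"
proof -
  define c where "c w = u (word_map w (carpet_pt 0))" for w
  have "(\<Sum>w\<in>words n. \<Sum>v\<in>words (Suc l). (c (w @ v) - c w)\<^sup>2) \<le>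
    (\<Sum>w\<in>words n. \<Sum>i<8. \<Sum>v\<in>words l.
        2 * (c ((w @ [i]) @ v) - c (w @ [i]))\<^sup>2 + 2 * (c (w @ [i]) - c w)\<^sup>2)"
    unfolding sum_words_Suc'[of _ l]
  proof (intro sum_mono)
    fix w i v
    show "(c (w @ i # v) - c w)\<^sup>2 \<le> 2 * (c ((w @ [i]) @ v) - c (w @ [i]))\<^sup>2 + 2 * (c (w @ [i]) - c w)\<^sup>2"
      using square_add_le2[of "c (w @ i # v) - c (w @ [i])" "c (w @ [i]) - c w"] by simp
  qed
  also have "\<dots> = 2 * (\<Sum>w\<in>words (Suc n). \<Sum>v\<in>words l. (c (w @ v) - c w)\<^sup>2) +
      8 ^ l * (2 * (\<Sum>w\<in>words n. \<Sum>i<8. (c (w @ [i]) - c w)\<^sup>2))"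
    unfolding sum_words_Suc by (simp add: sum.distrib sum_distrib_left card_words ac_simps)
  also have "(\<Sum>w\<in>words n. \<Sum>i<8. (c (w @ [i]) - c w)\<^sup>2) \<le>
      (\<Sum>w\<in>words n. \<Sum>i<8::nat. 56 * (\<Sum>j<8. edge_energy u (w @ [j])))"
    unfolding c_def by (intro sum_mono subcell_vertex_diff) auto
  also have "\<dots> = 448 * (\<Sum>w\<in>words (Suc n). edge_energy u w)"
    unfolding sum_words_Suc by (simp add: sum_distrib_left)
  finally have "(\<Sum>w\<in>words n. \<Sum>v\<in>words (Suc l). (c (w @ v) - c w)\<^sup>2) \<le>
      2 * (\<Sum>w\<in>words (Suc n). \<Sum>v\<in>words l. (c (w @ v) - c w)\<^sup>2) +
      8 ^ l * (896 * (\<Sum>w\<in>words (Suc n). edge_energy u w))"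
    by simp
  then have "(\<Sum>w\<in>words n. \<Sum>v\<in>words (Suc l). (c (w @ v) - c w)\<^sup>2) / 8 ^ Suc l \<le>
      (2 * (\<Sum>w\<in>words (Suc n). \<Sum>v\<in>words l. (c (w @ v) - c w)\<^sup>2) +
      8 ^ l * (896 * (\<Sum>w\<in>words (Suc n). edge_energy u w))) / 8 ^ Suc l"
    by (rule divide_right_mono) simp
  also have "\<dots> = 1 / 4 * ((\<Sum>w\<in>words (Suc n). \<Sum>v\<in>words l. (c (w @ v) - c w)\<^sup>2) / 8 ^ l) +
     112 * (\<Sum>w\<in>words (Suc n). edge_energy u w)"
    by (simp add: field_simps)
  finally show ?thesis unfolding vertex_spread_def c_def .
qed

text \<open>
  By uniform continuity the Riemann sums \<open>vertex_spread u l n\<close> control the integrals up to an error that vanishes as \<open>l\<close> tends to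
  infinity, so their one-step bound telescopes.
\<close>

lemma sum_vertex_deviation_le:
  fixes u :: "real^2 \<Rightarrow> real"
  assumes cont: "continuous_on carpet u" and meas: "u \<in> borel_measurable borel" and r: "r > 1 / 4"
  shows "(\<Sum>n. ennreal (r ^ n) * (ennreal (8 ^ n) * (\<Sum>w\<in>words n. vertex_deviation u w)))
    \<le> ennreal (2 * (r / (r - 1 / 4))) *
       (\<Sum>n. ennreal (r ^ n) * ennreal (112 * (\<Sum>w\<in>words (Suc n). edge_energy u w)))"
proof (rule telescoping_series)
  define E where "E l n = ennreal (8 ^ n) * (2 * (\<Sum>v\<in>words (n + l). vertex_deviation u v))" for l n
  show "ennreal (vertex_spread u 0 n) = 0" for n by (simp add: vertex_spread_def)
  show "ennreal (vertex_spread u (Suc l) n) \<le> ennreal (1 / 4) * ennreal (vertex_spread u l (Suc n)) +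
      ennreal (112 * (\<Sum>w\<in>words (Suc n). edge_energy u w))" for l n
  proof -
    have "ennreal (vertex_spread u (Suc l) n) \<le> ennreal (1 / 4 * vertex_spread u l (Suc n) +
     112 * (\<Sum>w\<in>words (Suc n). edge_energy u w))"
      by (rule ennreal_leI[OF vertex_spread_Suc])
    also have "\<dots> = ennreal (1 / 4 * vertex_spread u l (Suc n)) + ennreal (112 * (\<Sum>w\<in>words (Suc n). edge_energy u w))"
      by (rule ennreal_plus) (auto simp: vertex_spread_nonneg sum_nonneg edge_energy_nonneg)
    also have "ennreal (1 / 4 * vertex_spread u l (Suc n)) = ennreal (1 / 4) * ennreal (vertex_spread u l (Suc n))"
      by (rule ennreal_mult) (auto simp: vertex_spread_nonneg)
    finally show ?thesis .
  qed
  show "ennreal (8 ^ n) * (\<Sum>w\<in>words n. vertex_deviation u w) \<le>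
      ennreal 2 * ennreal (vertex_spread u l n) + E l n" for l n
  proof -
    define c where "c w = u (word_map w (carpet_pt 0))" for w
    have "(\<Sum>w\<in>words n. vertex_deviation u w) \<le>
      (\<Sum>w\<in>words n. \<Sum>v\<in>words l. 2 * vertex_deviation u (w @ v) + ennreal (2 * (c (w @ v) - c w)\<^sup>2 / 8 ^ (n + l)))"
      unfolding c_def by (intro sum_mono vertex_deviation_refine[OF meas])
    also have "\<dots> = 2 * (\<Sum>v\<in>words (n + l). vertex_deviation u v) +
        (\<Sum>w\<in>words n. \<Sum>v\<in>words l. ennreal (2 * (c (w @ v) - c w)\<^sup>2 / 8 ^ (n + l)))"
      unfolding sum_words_append by (simp add: sum.distrib sum_distrib_left)
    also have "(\<Sum>w\<in>words n. \<Sum>v\<in>words l. ennreal (2 * (c (w @ v) - c w)\<^sup>2 / 8 ^ (n + l)))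
        = ennreal (2 * vertex_spread u l n / 8 ^ n)"
      unfolding vertex_spread_def c_def
      by (simp add: sum_nonneg sum_distrib_left sum_divide_distrib power_add mult.commute)
    finally have "ennreal (8 ^ n) * (\<Sum>w\<in>words n. vertex_deviation u w) \<le>
        ennreal (8 ^ n) * (2 * (\<Sum>v\<in>words (n + l). vertex_deviation u v) + ennreal (2 * vertex_spread u l n / 8 ^ n))"
      by (rule mult_left_mono) simp
    also have "\<dots> = E l n + ennreal (8 ^ n) * ennreal (2 * vertex_spread u l n / 8 ^ n)"
      by (simp only: E_def distrib_left)
    also have "ennreal (8 ^ n) * ennreal (2 * vertex_spread u l n / 8 ^ n) = ennreal 2 * ennreal (vertex_spread u l n)"
      using vertex_spread_nonneg[of u l n] by (simp add: ennreal_mult'[symmetric] del: ennreal_numeral)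
    finally show ?thesis by (simp add: add.commute)
  qed
  show "(\<lambda>l. E l n) \<longlonglongrightarrow> 0" for n
  proof (rule order_tendstoI)
    fix a :: ennreal assume "0 < a"
    then obtain b where b: "0 < b" "b < a" using dense by blast
    then have "b < top" using le_less_trans[OF top_greatest] less_top by fastforce
    then obtain c where c: "b = ennreal c" "c > 0" using b
      by (metis ennreal_cases ennreal_less_zero_iff less_irrefl top.not_eq_extremum)
    \<comment> \<open>The oscillation that makes the bound for the error term \<open>E l n\<close> equal to \<open>c\<close>.\<close>
    define e where "e = sqrt (c / (2 * 8 ^ n))"
    have e: "e > 0" "e\<^sup>2 = c / (2 * 8 ^ n)" using c by (auto simp: e_def)
    obtain N where N: "\<And>n w x y. n \<ge> N \<Longrightarrow> w \<in> words n \<Longrightarrow> x \<in> cell w \<Longrightarrow> y \<in> cell w \<Longrightarrow> \<bar>u x - u y\<bar> \<le> e"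
      using carpet_oscillation[OF cont e(1)] by blast
    have "E l n < a" if "l \<ge> N" for l
    proof -
      have "(\<Sum>v\<in>words (n + l). vertex_deviation u v) \<le> (\<Sum>v\<in>words (n + l). ennreal (e\<^sup>2 / 8 ^ (n + l)))"
        using N[of "n + l"] e that by (intro sum_mono vertex_deviation_small) auto
      also have "\<dots> = ennreal (e\<^sup>2)"
        by (simp add: card_words ennreal_of_nat_eq_real_of_nat ennreal_mult'[symmetric])
      finally have "E l n \<le> ennreal (8 ^ n) * (2 * ennreal (e\<^sup>2))"
        unfolding E_def by (intro mult_left_mono) auto
      also have "\<dots> = ennreal (8 ^ n * (2 * e\<^sup>2))" by (simp add: ennreal_mult')
      also have "8 ^ n * (2 * e\<^sup>2) = c" by (simp add: e(2))
      finally show ?thesis using b c by simp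
    qed
    then show "\<forall>\<^sub>F l in sequentially. E l n < a" by (auto simp: eventually_sequentially)
  qed simp
qed (use r in auto)

text \<open>
  The kernel is distributed over the levels, at each level only touching pairs of cells matter, and a pair of touching cells is
  controlled by the deviations from their vertices and by the edges of the next level. Passing to the edges of the next level is also
  what makes the sum over the levels from 1 on sufficient, as the pairs at level 0 need only edges of level 1.
\<close>

lemma besov_le_discrete:
  assumes \<beta>: "\<beta> > carpet_dim"
  shows "\<exists>C\<ge>0. \<forall>u. continuous_on carpet u \<longrightarrow> u \<in> borel_measurable borel \<longrightarrow>
    besov_energy \<beta> u \<le> ennreal C * discrete_energy \<beta> u"
proof -
  define r where "r = 3 powr (\<beta> - carpet_dim)"
  have "r > 1" using \<beta> by (simp add: r_def)
  define s where "s = carpet_dim + \<beta>"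
  have "s > 0" using \<beta> carpet_dim_pos by (simp add: s_def)
  have rs: "(3 powr s) ^ m = r ^ m * 64 ^ m" for m
    unfolding r_def s_def by (rule power_weight_eq)
  define T where "T = 2 * (r / (r - 1 / 4))"
  have "T \<ge> 0" using \<open>r > 1\<close> by (simp add: T_def)
  define A where "A = 72 * 3 powr s"
  have "A \<ge> 0" by (simp add: A_def)
  have "besov_energy \<beta> u \<le> ennreal (A * (T * 112 + 56) * 14) * discrete_energy \<beta> u"
    if cont: "continuous_on carpet u" and meas: "u \<in> borel_measurable borel" for u
  proof -
    define D where "D n = (\<Sum>w\<in>words n. edge_energy u w)" for n
    have D0: "D n \<ge> 0" for n by (simp add: D_def sum_nonneg edge_energy_nonneg)
    define Y where "Y n = ennreal (8 ^ n) * (\<Sum>w\<in>words n. vertex_deviation u w)" for n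
    define Z where "Z = (\<Sum>n. ennreal (r ^ n) * ennreal (D (Suc n)))"
    have "besov_energy \<beta> u \<le>
      (\<Sum>n. ennreal ((3 powr s) ^ Suc n) * (\<Sum>w\<in>words n. \<Sum>v\<in>{v\<in>words n. touching w v}. cell_energy u w v))"
      by (rule besov_le_touching_energy[OF meas s_def \<open>s > 0\<close>])
    also have "\<dots> \<le> (\<Sum>n. ennreal A * (ennreal (r ^ n) * (Y n + ennreal (56 * D (Suc n)))))"
    proof (intro suminf_le allI)
      fix n
      define \<phi> where "\<phi> w = ennreal (4 / 8 ^ n) * vertex_deviation u w +
        ennreal (4 / 64 ^ n * (56 * (\<Sum>j<8. edge_energy u (w @ [j]))))" for w
      have "(\<Sum>w\<in>words n. \<Sum>v\<in>{v\<in>words n. touching w v}. cell_energy u w v) \<le>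
          (\<Sum>w\<in>words n. \<Sum>v\<in>{v\<in>words n. touching w v}. \<phi> w + \<phi> v)"
        unfolding \<phi>_def by (intro sum_mono touching_cell_energy[OF meas]) auto
      also have "\<dots> \<le> 18 * (\<Sum>w\<in>words n. \<phi> w)" by (rule sum_touching_le)
      also have "(\<Sum>w\<in>words n. \<phi> w) = ennreal (4 / 8 ^ n) * (\<Sum>w\<in>words n. vertex_deviation u w) +
          ennreal (4 / 64 ^ n * (56 * D (Suc n)))"
        unfolding \<phi>_def D_def sum_words_Suc sum.distrib
        by (simp add: sum_distrib_left sum_nonneg edge_energy_nonneg)
      also have "\<dots> = ennreal (4 / 64 ^ n) * (Y n + ennreal (56 * D (Suc n)))"
      proof -
        have "(4::real) / 8 ^ n = 4 / 64 ^ n * 8 ^ n"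
          by (simp add: field_simps power_mult_distrib[symmetric])
        then have "ennreal (4 / 8 ^ n) = ennreal (4 / 64 ^ n) * ennreal (8 ^ n)"
          by (simp only: ennreal_mult' zero_le_power zero_le_numeral ennreal_mult'' )
        moreover have "ennreal (4 / 64 ^ n * (56 * D (Suc n))) = ennreal (4 / 64 ^ n) * ennreal (56 * D (Suc n))"
          by (rule ennreal_mult) (use D0[of "Suc n"] in auto)
        ultimately show ?thesis by (simp only: Y_def distrib_left mult.assoc)
      qed
      finally have "ennreal ((3 powr s) ^ Suc n) * (\<Sum>w\<in>words n. \<Sum>v\<in>{v\<in>words n. touching w v}. cell_energy u w v)
         \<le> ennreal ((3 powr s) ^ Suc n) * (18 * (ennreal (4 / 64 ^ n) * (Y n + ennreal (56 * D (Suc n)))))"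
        by (rule mult_left_mono) simp
      also have "\<dots> = ennreal ((3 powr s) ^ Suc n * (18 * (4 / 64 ^ n))) * (Y n + ennreal (56 * D (Suc n)))"
      proof -
        have product: "ennreal (a * (18 * b)) = ennreal a * (18 * ennreal b)" if "a \<ge> 0" "b \<ge> 0" for a b
          using that by (simp add: ennreal_mult')
        have "ennreal ((3 powr s) ^ Suc n * (18 * (4 / 64 ^ n))) =
            ennreal ((3 powr s) ^ Suc n) * (18 * ennreal (4 / 64 ^ n))"
          by (rule product) auto
        then show ?thesis by (simp only: mult.assoc)
      qed
      also have "(3 powr s) ^ Suc n * (18 * (4 / 64 ^ n)) = A * r ^ n"
        unfolding power_Suc rs A_def by simp
      also have "ennreal (A * r ^ n) * (Y n + ennreal (56 * D (Suc n))) =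
          ennreal A * (ennreal (r ^ n) * (Y n + ennreal (56 * D (Suc n))))"
        using \<open>A \<ge> 0\<close> by (simp add: ennreal_mult' mult.assoc)
      finally show "ennreal ((3 powr s) ^ Suc n) * (\<Sum>w\<in>words n. \<Sum>v\<in>{v\<in>words n. touching w v}. cell_energy u w v)
         \<le> ennreal A * (ennreal (r ^ n) * (Y n + ennreal (56 * D (Suc n))))" .
    qed auto
    also have "\<dots> = ennreal A * ((\<Sum>n. ennreal (r ^ n) * Y n) + (\<Sum>n. ennreal (r ^ n) * ennreal (56 * D (Suc n))))"
      unfolding ennreal_suminf_cmult by (subst suminf_add) (simp_all add: distrib_left)
    also have "\<dots> \<le> ennreal A * (ennreal T * (\<Sum>n. ennreal (r ^ n) * ennreal (112 * D (Suc n))) +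
        (\<Sum>n. ennreal (r ^ n) * ennreal (56 * D (Suc n))))"
      unfolding Y_def T_def D_def using \<open>r > 1\<close>
      by (intro mult_left_mono add_right_mono sum_vertex_deviation_le[OF cont meas]) auto
    also have "\<dots> = ennreal A * (ennreal (T * 112 + 56) * Z)"
    proof -
      have pull: "(\<Sum>n. ennreal (r ^ n) * ennreal (k * D (Suc n))) = ennreal k * Z" if "k \<ge> 0" for k
        unfolding Z_def ennreal_suminf_cmult[symmetric]
        using that by (intro suminf_cong) (simp add: ennreal_mult' mult.left_commute)
      have "ennreal (T * 112 + 56) = ennreal T * ennreal 112 + ennreal 56"
        using \<open>T \<ge> 0\<close> by (simp add: ennreal_mult')
      then show ?thesis using pull[of 112] pull[of 56] by (simp add: distrib_right mult.assoc)
    qed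
    also have "Z \<le> ennreal 14 * discrete_energy \<beta> u"
      unfolding Z_def discrete_energy_def ennreal_suminf_cmult[symmetric]
    proof (intro suminf_le allI)
      fix n
      have "r ^ n * D (Suc n) \<le> r ^ Suc n * D (Suc n)"
        using \<open>r > 1\<close> D0 by (intro mult_right_mono power_increasing) auto
      also have "\<dots> \<le> 14 * level_energy \<beta> (Suc n) u"
        unfolding r_def D_def by (rule edge_energy_le_level_energy)
      finally have "ennreal (r ^ n * D (Suc n)) \<le> ennreal (14 * level_energy \<beta> (Suc n) u)" by (rule ennreal_leI)
      then show "ennreal (r ^ n) * ennreal (D (Suc n)) \<le> ennreal 14 * ennreal (level_energy \<beta> (Suc n) u)"
        using \<open>r > 1\<close> by (simp add: ennreal_mult')
    qed auto
    finally have "besov_energy \<beta> u \<le> ennreal A * (ennreal (T * 112 + 56) * (ennreal 14 * discrete_energy \<beta> u))"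
      by (simp add: mult_left_mono)
    also have "\<dots> = ennreal (A * (T * 112 + 56) * 14) * discrete_energy \<beta> u"
    proof -
      have product: "ennreal a * (ennreal b * (ennreal 14 * x)) = ennreal (a * b * 14) * x"
        if "a \<ge> 0" "b \<ge> 0" for a b x
        using that by (simp add: ennreal_mult mult.assoc del: ennreal_numeral)
      show ?thesis by (rule product) (use \<open>A \<ge> 0\<close> \<open>T \<ge> 0\<close> in auto)
    qed
    finally show ?thesis .
  qed
  moreover have "A * (T * 112 + 56) * 14 \<ge> 0" using \<open>T \<ge> 0\<close> \<open>A \<ge> 0\<close> by simp
  ultimately show ?thesis by blast
qed

lemma level_energy_cong:
  assumes "\<And>x. x \<in> carpet \<Longrightarrow> u x = v x"
  shows "level_energy \<beta> n u = level_energy \<beta> n v"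
proof -
  have "p \<in> carpet" if "w \<in> words n" "p \<in> cell_vertices w" for w p
    using that vertex_in_cell cell_subset_carpet by (fastforce simp: cell_vertices_def)
  then show ?thesis unfolding level_energy_def
    by (intro arg_cong2[where f="(*)"] refl sum.cong arg_cong2[where f="(/)"])
       (auto simp: assms)
qed

lemma besov_energy_cong:
  assumes "\<And>x. x \<in> carpet \<Longrightarrow> u x = v x"
  shows "besov_energy \<beta> u = besov_energy \<beta> v"
  unfolding besov_energy_alt using assms
  by (intro nn_integral_cong) (auto split: split_indicator)

theorem lemma2p1:
  shows "\<forall>\<beta>::real. \<beta> > carpet_dim \<longrightarrow>
           (\<exists>C::real. C \<ge> 1 \<and>
              (\<forall>u :: real^2 \<Rightarrow> real. continuous_on carpet u \<longrightarrow>
                 ennreal (1 / C) * besov_energy \<beta> u \<le> discrete_energy \<beta> u \<and>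
                 discrete_energy \<beta> u \<le> ennreal C * besov_energy \<beta> u))"
proof (intro allI impI)
  fix \<beta> :: real assume \<beta>: "\<beta> > carpet_dim"
  obtain C1 where C1: "C1 \<ge> 0" "\<And>u. continuous_on carpet u \<Longrightarrow> u \<in> borel_measurable borel \<Longrightarrow>
    discrete_energy \<beta> u \<le> ennreal C1 * besov_energy \<beta> u"
    using discrete_le_besov[OF \<beta>] by blast
  obtain C2 where C2: "C2 \<ge> 0" "\<And>u. continuous_on carpet u \<Longrightarrow> u \<in> borel_measurable borel \<Longrightarrow>
    besov_energy \<beta> u \<le> ennreal C2 * discrete_energy \<beta> u"
    using besov_le_discrete[OF \<beta>] by blast
  define C where "C = max 1 (max C1 C2)"
  have C: "C \<ge> 1" "C \<ge> C1" "C \<ge> C2" by (auto simp: C_def)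
  show "\<exists>C\<ge>1. \<forall>u. continuous_on carpet u \<longrightarrow>
      ennreal (1 / C) * besov_energy \<beta> u \<le> discrete_energy \<beta> u \<and>
      discrete_energy \<beta> u \<le> ennreal C * besov_energy \<beta> u"
  proof (intro exI[of _ C] conjI allI impI)
    fix u :: "real^2 \<Rightarrow> real" assume cont: "continuous_on carpet u"
    \<comment> \<open>Both energies see only the values on the carpet, so \<open>u\<close> may be cut off to a Borel function on the plane.\<close>
    define v where "v x = indicator carpet x *\<^sub>R u x" for x
    have uv: "u x = v x" if "x \<in> carpet" for x using that by (simp add: v_def)
    have meas: "v \<in> borel_measurable borel"
      unfolding v_def by (rule borel_measurable_continuous_on_indicator[OF _ cont]) simp
    have cont_v: "continuous_on carpet v" using cont by (simp add: uv cong: continuous_on_cong)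
    have eq: "discrete_energy \<beta> u = discrete_energy \<beta> v" "besov_energy \<beta> u = besov_energy \<beta> v"
      unfolding discrete_energy_def using level_energy_cong[OF uv] besov_energy_cong[OF uv] by auto
    have "besov_energy \<beta> v \<le> ennreal C * discrete_energy \<beta> v"
      by (rule order_trans[OF C2(2)[OF cont_v meas]]) (intro mult_right_mono ennreal_leI C, simp)
    then have "ennreal (1 / C) * besov_energy \<beta> v \<le> ennreal (1 / C) * (ennreal C * discrete_energy \<beta> v)"
      by (rule mult_left_mono) simp
    also have "\<dots> = discrete_energy \<beta> v"
      using C by (simp add: mult.assoc[symmetric] ennreal_mult'[symmetric])
    finally show "ennreal (1 / C) * besov_energy \<beta> u \<le> discrete_energy \<beta> u" by (simp add: eq)
    show "discrete_energy \<beta> u \<le> ennreal C * besov_energy \<beta> u" unfolding eq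
      by (rule order_trans[OF C1(2)[OF cont_v meas]]) (intro mult_right_mono ennreal_leI C, simp)
  qed (use C in simp)
qed

end
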